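(* Let $\xi=(\xi_1,\xi_2,\ldots)$ be a swap-invariant sequence of random variables such that $\xi_1\neq0$ almost surely. Let $\tilde\xi=(\xi_2/|\xi_1|,\xi_3/|\xi_1|,\ldots)$, let $\varepsilon$ be a Rademacher random variable independent of $\xi$ under $\mathbf{P}$, and let $\varepsilon\tilde\xi=(\varepsilon\xi_2/|\xi_1|,\varepsilon\xi_3/|\xi_1|,\ldots)$. Then $$\frac1n\sum_{i=1}^n\xi_i\ \to\ \frac{|\xi_1|}{\mathbf{E}(|\xi_1|\mid\mathcal{E}_{\varepsilon\tilde\xi})\,\varepsilon}\,\mathbf{E}(\varepsilon\xi_2\mid\mathcal{E}_{\varepsilon\tilde\xi})\qquad\text{almost surely and in }L^1\text{ as }n\to\infty .$$
   Context: Two integrable random vectors $\xi,\xi^*$ in $\mathbb{R}^d$ are zonoid equivalent if $\mathbf{E}|\langle u,\xi\rangle|=\mathbf{E}|\langle u,\xi^*\rangle|$ for all $u\in\mathbb{R}^d$. An integrable random vector is swap-invariant if all random vectors obtained by permutations of its coordinates are zonoid equivalent. A sequence of integrable random variables is swap-invariant if all its finite subsequences are swap-invariant (as random vectors). A Rademacher random variable takes the values $\pm1$ with probability $1/2$ each. For a random sequence $\zeta=(\zeta_1,\zeta_2,\ldots)$, $\mathcal{E}_\zeta$ denotes its permutation-invariant $\sigma$-field, i.e. the $\sigma$-field of events $\{\zeta\in B\}$ with $B\subset\mathbb{R}^\infty$ measurable and invariant under all finite permutations of coordinates. Expectations and conditional expectations are with respect to the underlying probability measure $\mathbf{P}$.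 *)

theory Defs
  imports "HOL-Probability.Probability"
begin

text \<open>
  A random vector in \<open>\<real>\<^sup>d\<close> is a family \<open>X :: nat \<Rightarrow> 'a \<Rightarrow> real\<close> of which only the coordinates
  \<open>X 0, \<dots>, X (d - 1)\<close> matter; likewise only \<open>u 0, \<dots>, u (d - 1)\<close> of a vector \<open>u :: nat \<Rightarrow> real\<close>.
  Random sequences are indexed from 0.
\<close>

definition integrable_vector :: "'a measure \<Rightarrow> nat \<Rightarrow> (nat \<Rightarrow> 'a \<Rightarrow> real) \<Rightarrow> bool" where
  "integrable_vector M d X \<longleftrightarrow> (\<forall>i<d. integrable M (X i))"

definition zonoid_equivalent ::
  "nat \<Rightarrow> 'a measure \<Rightarrow> (nat \<Rightarrow> 'a \<Rightarrow> real) \<Rightarrow> 'b measure \<Rightarrow> (nat \<Rightarrow> 'b \<Rightarrow> real) \<Rightarrow> bool" where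
  "zonoid_equivalent d M X N Y \<longleftrightarrow>
     integrable_vector M d X \<and> integrable_vector N d Y \<and>
     (\<forall>u :: nat \<Rightarrow> real.
        (\<integral>\<omega>. \<bar>\<Sum>i<d. u i * X i \<omega>\<bar> \<partial>M) = (\<integral>\<omega>. \<bar>\<Sum>i<d. u i * Y i \<omega>\<bar> \<partial>N))"

definition swap_invariant_vector :: "'a measure \<Rightarrow> nat \<Rightarrow> (nat \<Rightarrow> 'a \<Rightarrow> real) \<Rightarrow> bool" where
  "swap_invariant_vector M d X \<longleftrightarrow>
     integrable_vector M d X \<and>
     (\<forall>\<pi> \<sigma>. \<pi> permutes {..<d} \<longrightarrow> \<sigma> permutes {..<d} \<longrightarrow>
        zonoid_equivalent d M (\<lambda>i. X (\<pi> i)) M (\<lambda>i. X (\<sigma> i)))"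

definition swap_invariant_sequence :: "'a measure \<Rightarrow> (nat \<Rightarrow> 'a \<Rightarrow> real) \<Rightarrow> bool" where
  "swap_invariant_sequence M X \<longleftrightarrow>
     (\<forall>i. integrable M (X i)) \<and>
     (\<forall>d s. strict_mono_on {..<d} s \<longrightarrow> swap_invariant_vector M d (\<lambda>i. X (s i)))"

definition rademacher :: "'a measure \<Rightarrow> ('a \<Rightarrow> real) \<Rightarrow> bool" where
  "rademacher M \<epsilon> \<longleftrightarrow> \<epsilon> \<in> borel_measurable M \<and>
     measure M {\<omega> \<in> space M. \<epsilon> \<omega> = 1} = 1 / 2 \<and>
     measure M {\<omega> \<in> space M. \<epsilon> \<omega> = - 1} = 1 / 2"

abbreviation real_sequences :: "(nat \<Rightarrow> real) measure" where
  "real_sequences \<equiv> PiM UNIV (\<lambda>_. borel)"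

text \<open>
  The library's \<open>indep_var\<close> forces both random variables to have the same value type; the following
  is independence for different value types.
\<close>

definition independent_rvs ::
  "'a measure \<Rightarrow> 'b measure \<Rightarrow> ('a \<Rightarrow> 'b) \<Rightarrow> 'c measure \<Rightarrow> ('a \<Rightarrow> 'c) \<Rightarrow> bool" where
  "independent_rvs M S X T Y \<longleftrightarrow>
     X \<in> measurable M S \<and> Y \<in> measurable M T \<and>
     prob_space.indep_set M {X -` A \<inter> space M | A. A \<in> sets S} {Y -` B \<inter> space M | B. B \<in> sets T}"

definition permutation_invariant :: "(nat \<Rightarrow> real) set \<Rightarrow> bool" where
  "permutation_invariant B \<longleftrightarrow>
     (\<forall>\<pi> I. finite I \<longrightarrow> \<pi> permutes I \<longrightarrow> (\<forall>x. (\<lambda>i. x (\<pi> i)) \<in> B \<longleftrightarrow> x \<in> B))"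

text \<open>
  The generating family is itself a \<open>\<sigma>\<close>-algebra, see \<open>sets_permutation_invariant_field\<close> below.
\<close>

definition permutation_invariant_field :: "'a measure \<Rightarrow> (nat \<Rightarrow> 'a \<Rightarrow> real) \<Rightarrow> 'a measure" where
  "permutation_invariant_field M \<zeta> = sigma (space M)
     {{\<omega> \<in> space M. (\<lambda>i. \<zeta> i \<omega>) \<in> B} | B. B \<in> sets real_sequences \<and> permutation_invariant B}"

definition converges_in_L1 :: "'a measure \<Rightarrow> (nat \<Rightarrow> 'a \<Rightarrow> real) \<Rightarrow> ('a \<Rightarrow> real) \<Rightarrow> bool" where
  "converges_in_L1 M X L \<longleftrightarrow>
     (\<forall>n. integrable M (X n)) \<and> integrable M L \<and> (\<lambda>n. \<integral>\<omega>. \<bar>X n \<omega> - L \<omega>\<bar> \<partial>M) \<longlonglongrightarrow> 0"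

lemma sets_permutation_invariant_field:
  "sets (permutation_invariant_field M \<zeta>) =
     {{\<omega> \<in> space M. (\<lambda>i. \<zeta> i \<omega>) \<in> B} | B. B \<in> sets real_sequences \<and> permutation_invariant B}"
proof -
  define E where "E = {{\<omega> \<in> space M. (\<lambda>i. \<zeta> i \<omega>) \<in> B} | B.
    B \<in> sets real_sequences \<and> permutation_invariant B}"
  have E_iff: "A \<in> E \<longleftrightarrow> (\<exists>B. A = {\<omega> \<in> space M. (\<lambda>i. \<zeta> i \<omega>) \<in> B} \<and>
    B \<in> sets real_sequences \<and> permutation_invariant B)" for A
    unfolding E_def by (rule mem_Collect_eq)
  have "sigma_algebra (space M) E"
    unfolding sigma_algebra_iff2
  proof (intro conjI ballI allI impI)
    show "E \<subseteq> Pow (space M)" unfolding E_def by auto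
    show "{} \<in> E"
      unfolding E_iff by (rule exI[of _ "{}"]) (simp add: permutation_invariant_def)
  next
    fix A assume "A \<in> E"
    then obtain B where B: "A = {\<omega> \<in> space M. (\<lambda>i. \<zeta> i \<omega>) \<in> B}" "B \<in> sets real_sequences"
      "permutation_invariant B" unfolding E_iff by (elim exE conjE)
    have "- B \<in> sets real_sequences"
      using sets.compl_sets[OF B(2)] by (simp add: space_PiM Compl_eq_Diff_UNIV PiE_UNIV_domain)
    moreover have "permutation_invariant (- B)"
      using B(3) by (simp add: permutation_invariant_def)
    moreover have "space M - A = {\<omega> \<in> space M. (\<lambda>i. \<zeta> i \<omega>) \<in> - B}"
      using B(1) by auto
    ultimately show "space M - A \<in> E"
      unfolding E_iff by (intro exI[of _ "- B"] conjI)
  next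
    fix A :: "nat \<Rightarrow> _" assume "range A \<subseteq> E"
    then have "\<forall>n. A n \<in> E" by (simp add: image_subset_iff)
    then have "\<forall>n. \<exists>B. A n = {\<omega> \<in> space M. (\<lambda>i. \<zeta> i \<omega>) \<in> B} \<and> B \<in> sets real_sequences \<and>
      permutation_invariant B" unfolding E_iff .
    then obtain B where B: "\<And>n. A n = {\<omega> \<in> space M. (\<lambda>i. \<zeta> i \<omega>) \<in> B n}"
      "\<And>n. B n \<in> sets real_sequences" "\<And>n. permutation_invariant (B n)" unfolding choice_iff by blast
    have "(\<Union>n. B n) \<in> sets real_sequences" by (rule sets.countable_UN) (simp add: B(2) image_subset_iff)
    moreover have "permutation_invariant (\<Union>n. B n)"
      using B(3) by (simp add: permutation_invariant_def)
    moreover have "(\<Union>n. A n) = {\<omega> \<in> space M. (\<lambda>i. \<zeta> i \<omega>) \<in> (\<Union>n. B n)}"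
      using B(1) by auto
    ultimately show "(\<Union>n. A n) \<in> E"
      unfolding E_iff by (intro exI[of _ "\<Union>n. B n"] conjI)
  qed
  then show ?thesis
    unfolding permutation_invariant_field_def E_def[symmetric]
    by (rule sigma_algebra.sets_measure_of_eq)
qed

lemma subalgebra_permutation_invariant_field:
  assumes "\<And>i. \<zeta> i \<in> borel_measurable M"
  shows "subalgebra M (permutation_invariant_field M \<zeta>)"
proof -
  have m: "(\<lambda>\<omega> i. \<zeta> i \<omega>) \<in> measurable M real_sequences"
    by (rule measurable_PiM_single') (use assms in \<open>auto simp: space_PiM\<close>)
  have "{\<omega> \<in> space M. (\<lambda>i. \<zeta> i \<omega>) \<in> B} \<in> sets M" if "B \<in> sets real_sequences" for B
    using measurable_sets[OF m that] by (simp add: vimage_def Int_def conj_commute)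
  then show ?thesis
    unfolding subalgebra_def sets_permutation_invariant_field
    by (auto simp: permutation_invariant_field_def space_measure_of_conv)
qed

end

theory Submission
  imports Defs
begin

text \<open>
  Let \<open>\<eta> i = \<epsilon> \<xi> (i + 1) / \<bar>\<xi> 0\<bar>\<close> and let \<open>N\<close> be the law of \<open>\<eta>\<close> under the measure with density
  \<open>\<bar>\<xi> 0\<bar>\<close>. Independence of \<open>\<epsilon>\<close> turns swap invariance into permutation invariance of
  \<open>\<integral> \<bar>\<langle>u, x\<rangle> - a\<bar> dN\<close> for all \<open>u\<close> and \<open>a\<close>. As functions of \<open>a\<close> these integrals determine the
  \<open>N\<close>-law of every linear form, hence \<open>N\<close> itself, so \<open>N\<close> is exchangeable and the strong law for
  exchangeable sequences applies. The change of measure expresses the limit \<open>E\<^sub>N (\<eta> 0 | \<E>)\<close> as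
  \<open>E (\<epsilon> \<xi> 1 | \<E>) / E (\<bar>\<xi> 0\<bar> | \<E>)\<close>.
\<close>

section \<open>The strong law of large numbers for exchangeable measures\<close>

text \<open>Swap invariance speaks only of integrals of absolute values of linear forms. For a
  single direction this fixes one number, not a law. The weight \<open>\<bar>\<xi> 0\<bar>\<close>
  supplies the missing parameter: after division by it, coordinate 0 has become a constant, and its
  coefficient is the free shift \<open>a\<close>. The price is the sign of \<open>\<xi> 0\<close>:
  with \<open>y\<close> for \<open>\<xi> 0\<close> and \<open>z\<close> for a form in the later
  coordinates, \<open>\<bar>z - a * \<bar>y\<bar>\<bar>\<close> is not the absolute value of a
  linear form in \<open>y\<close> and \<open>z\<close>. Averaging over the independent sign repairs
  this, since the contributions of \<open>z\<close> and \<open>- z\<close> add up to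
  \<open>\<bar>a * y + z\<bar> + \<bar>(- a) * y + z\<bar>\<close> whatever the sign of
  \<open>y\<close>. The weight also makes the coordinates integrable under \<open>N\<close>,
  although \<open>\<eta>\<close> may fail to be integrable under the original measure, and it turns
  the L1 error of the averages under \<open>N\<close> into the error for \<open>\<xi>\<close>. As
  \<open>N\<close> has mass \<open>E \<bar>\<xi> 0\<bar>\<close>, finite measures replace
  probability measures.\<close>

locale exchangeable_measure = finite_measure N for N :: "(nat \<Rightarrow> real) measure" +
  assumes sets_eq [measurable_cong]: "sets N = sets real_sequences"
    and distr_perm: "\<And>I \<pi>. finite I \<Longrightarrow> \<pi> permutes I \<Longrightarrow> distr N real_sequences (\<lambda>x i. x (\<pi> i)) = N"

lemma space_real_sequences [simp]: "space real_sequences = UNIV"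
  by (simp add: space_PiM PiE_UNIV_domain)

lemma measurable_reindex: "(\<lambda>x i. x (\<pi> i)) \<in> measurable real_sequences real_sequences"
  by (rule measurable_PiM_single') (auto simp: space_PiM)

text \<open>The empty sum \<open>k = 0\<close> competes too, which makes the maximum nonnegative; it
  is the maximal function in Garsia's argument.\<close>

definition max_partial_sum :: "nat \<Rightarrow> (nat \<Rightarrow> real) \<Rightarrow> real" where
  "max_partial_sum n a = Max ((\<lambda>k. \<Sum>i<k. a i) ` {..n})"

lemma partial_sum_le_max: "k \<le> n \<Longrightarrow> (\<Sum>i<k. a i) \<le> max_partial_sum n a"
  unfolding max_partial_sum_def by (rule Max_ge) auto

lemma max_partial_sum_nonneg: "0 \<le> max_partial_sum n a"
  using partial_sum_le_max[of 0 n a] by simp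

lemma max_partial_sum_attained: "\<exists>k\<le>n. max_partial_sum n a = (\<Sum>i<k. a i)"
proof -
  have "max_partial_sum n a \<in> (\<lambda>k. \<Sum>i<k. a i) ` {..n}"
    unfolding max_partial_sum_def by (rule Max_in) auto
  then show ?thesis by auto
qed

lemma max_partial_sum_pos_iff: "max_partial_sum n a > 0 \<longleftrightarrow> (\<exists>k\<le>n. (\<Sum>i<k. a i) > 0)"
  using max_partial_sum_attained[of n a] partial_sum_le_max[of _ n a] by (metis less_le_trans)

text \<open>A positive maximum is not attained by the empty sum, so the first term can be split off;
  what remains is one of the partial sums of the shifted sequence.\<close>

lemma max_partial_sum_shift:
  assumes "max_partial_sum n a > 0"
  shows "max_partial_sum n a \<le> a 0 + max_partial_sum n (\<lambda>i. a (Suc i))"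
proof -
  obtain k where k: "k \<le> n" "max_partial_sum n a = (\<Sum>i<k. a i)"
    using max_partial_sum_attained by blast
  with assms obtain l where l: "k = Suc l" by (cases k) auto
  have "(\<Sum>i<k. a i) = a 0 + (\<Sum>i<l. a (Suc i))"
    unfolding l by (rule sum.lessThan_Suc_shift)
  then show ?thesis
    using k l partial_sum_le_max[of l n "\<lambda>i. a (Suc i)"] by simp
qed

lemma abs_max_partial_sum_le: "\<bar>max_partial_sum n a\<bar> \<le> (\<Sum>i<n. \<bar>a i\<bar>)"
proof -
  obtain k where k: "k \<le> n" "max_partial_sum n a = (\<Sum>i<k. a i)"
    using max_partial_sum_attained by blast
  have "\<bar>\<Sum>i<k. a i\<bar> \<le> (\<Sum>i<k. \<bar>a i\<bar>)" by (rule sum_abs)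
  also have "\<dots> \<le> (\<Sum>i<n. \<bar>a i\<bar>)" by (rule sum_mono2) (use k in auto)
  finally show ?thesis using k by simp
qed

lemma max_partial_sum_cong: "(\<And>i. i < n \<Longrightarrow> a i = b i) \<Longrightarrow> max_partial_sum n a = max_partial_sum n b"
proof -
  assume "\<And>i. i < n \<Longrightarrow> a i = b i"
  then have "(\<Sum>i<k. a i) = (\<Sum>i<k. b i)" if "k \<le> n" for k
    using that by simp
  then have "(\<lambda>k. \<Sum>i<k. a i) ` {..n} = (\<lambda>k. \<Sum>i<k. b i) ` {..n}"
    by (rule image_cong[OF refl]) simp
  then show ?thesis
    unfolding max_partial_sum_def by (rule arg_cong)
qed

lemma measurable_max_partial_sum:
  assumes [measurable]: "\<And>i. (\<lambda>x. Z i x) \<in> borel_measurable M"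
  shows "(\<lambda>x. max_partial_sum n (\<lambda>i. Z i x)) \<in> borel_measurable M"
  unfolding max_partial_sum_def
proof (rule borel_measurable_Max)
  show "(\<lambda>x. \<Sum>i<k. Z i x) \<in> borel_measurable M" for k
    by (rule borel_measurable_sum) (rule assms)
qed simp

lemma integrable_max_partial_sum:
  assumes int: "\<And>i. integrable M (Z i)"
  shows "integrable M (\<lambda>x. max_partial_sum n (\<lambda>i. Z i x))"
proof (rule Bochner_Integration.integrable_bound[where f="\<lambda>x. \<Sum>i<n. \<bar>Z i x\<bar>"])
  show "(\<lambda>x. max_partial_sum n (\<lambda>i. Z i x)) \<in> borel_measurable M"
    by (rule measurable_max_partial_sum) (rule borel_measurable_integrable[OF int])
  show "integrable M (\<lambda>x. \<Sum>i<n. \<bar>Z i x\<bar>)"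
    by (rule Bochner_Integration.integrable_sum) (rule integrable_abs[OF int])
  show "AE x in M. norm (max_partial_sum n (\<lambda>i. Z i x)) \<le> norm (\<Sum>i<n. \<bar>Z i x\<bar>)"
    using abs_max_partial_sum_le[of n "\<lambda>i. Z i _"] by (intro AE_I2) (simp add: sum_nonneg)
qed

section \<open>Permutation invariance of integrals and the maximal inequality\<close>

context exchangeable_measure
begin

lemma space_eq [simp]: "space N = UNIV"
  using sets_eq_imp_space_eq[OF sets_eq] by simp

lemma measurable_reindex_N: "(\<lambda>x i. x (\<pi> i)) \<in> measurable N real_sequences"
  using measurable_reindex by (simp only: measurable_cong_sets[OF sets_eq refl])

lemma borel_measurable_iff: "h \<in> borel_measurable N \<longleftrightarrow> h \<in> borel_measurable real_sequences"
  by (simp only: measurable_cong_sets[OF sets_eq refl])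

lemma integrable_perm_iff:
  fixes h :: "(nat \<Rightarrow> real) \<Rightarrow> real"
  assumes "finite I" "\<pi> permutes I" and "h \<in> borel_measurable N"
  shows "integrable N (\<lambda>x. h (\<lambda>i. x (\<pi> i))) \<longleftrightarrow> integrable N h"
proof -
  have "integrable (distr N real_sequences (\<lambda>x i. x (\<pi> i))) h \<longleftrightarrow> integrable N (\<lambda>x. h (\<lambda>i. x (\<pi> i)))"
    by (rule integrable_distr_eq[OF measurable_reindex_N]) (rule assms(3)[unfolded borel_measurable_iff])
  then show ?thesis by (simp only: distr_perm[OF assms(1,2)])
qed

lemma integral_perm:
  fixes h :: "(nat \<Rightarrow> real) \<Rightarrow> real"
  assumes "finite I" "\<pi> permutes I" and "h \<in> borel_measurable N"
  shows "(\<integral>x. h (\<lambda>i. x (\<pi> i)) \<partial>N) = (\<integral>x. h x \<partial>N)"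
proof -
  have "integral\<^sup>L (distr N real_sequences (\<lambda>x i. x (\<pi> i))) h = (\<integral>x. h (\<lambda>i. x (\<pi> i)) \<partial>N)"
    by (rule integral_distr[OF measurable_reindex_N]) (rule assms(3)[unfolded borel_measurable_iff])
  then show ?thesis by (simp only: distr_perm[OF assms(1,2)])
qed

text \<open>
  Garsia's proof of the maximal ergodic inequality. A cyclic permutation of the first \<open>n + 1\<close>
  coordinates replaces the shift, so invariance under finite permutations suffices.
\<close>

lemma maximal_inequality:
  fixes Z :: "nat \<Rightarrow> (nat \<Rightarrow> real) \<Rightarrow> real"
  assumes [measurable]: "\<And>i. Z i \<in> borel_measurable N"
    and int0: "integrable N (Z 0)"
    and equi: "\<And>I \<pi> i x. finite I \<Longrightarrow> \<pi> permutes I \<Longrightarrow> Z i (\<lambda>j. x (\<pi> j)) = Z (\<pi> i) x"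
  shows "0 \<le> (\<integral>x. indicator {x. \<exists>k. (\<Sum>i<k. Z i x) > 0} x * Z 0 x \<partial>N)"
proof -
  have int: "integrable N (Z i)" for i
  proof -
    have p: "Transposition.transpose 0 i permutes {0, i}" by (rule permutes_swap_id) auto
    have "Z 0 (\<lambda>j. x (Transposition.transpose 0 i j)) = Z i x" for x
      using equi[OF _ p, of 0 x] by simp
    then show ?thesis
      using integrable_perm_iff[OF _ p, of "Z 0"] int0 by simp
  qed
  have int_max: "integrable N (\<lambda>x. max_partial_sum n (\<lambda>i. Z (s i) x))" for n s
    by (rule integrable_max_partial_sum) (rule int)
  have fin: "0 \<le> (\<integral>x. indicator {x. \<exists>k\<le>n. (\<Sum>i<k. Z i x) > 0} x * Z 0 x \<partial>N)" for n
  proof -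
    \<comment> \<open>\<open>max_partial_sum n\<close> reads only indices below \<open>n\<close>,
      where this cycle agrees with \<open>Suc\<close>; the wrap-around from \<open>n\<close> to 0 is
      never seen.\<close>
    define \<sigma> where "\<sigma> = (\<lambda>i. if i < n then Suc i else if i = n then 0 else i)"
    have "\<sigma> permutes {..n}"
    proof (rule bij_imp_permutes)
      show "bij_betw \<sigma> {..n} {..n}"
        by (rule bij_betw_byWitness[where f'="\<lambda>i. if i = 0 then n else i - 1"]) (auto simp: \<sigma>_def)
      show "\<sigma> x = x" if "x \<notin> {..n}" for x
        using that by (simp add: \<sigma>_def)
    qed
    have \<sigma>: "max_partial_sum n (\<lambda>i. Z i (\<lambda>j. x (\<sigma> j))) = max_partial_sum n (\<lambda>i. Z (Suc i) x)" for x
    proof (rule max_partial_sum_cong)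
      fix i assume "i < n"
      then have "\<sigma> i = Suc i" by (simp add: \<sigma>_def)
      with equi[OF finite_atMost \<open>\<sigma> permutes {..n}\<close>, of i x] show "Z i (\<lambda>j. x (\<sigma> j)) = Z (Suc i) x"
        by (simp only:)
    qed
    have eq: "(\<integral>x. max_partial_sum n (\<lambda>i. Z (Suc i) x) \<partial>N) = (\<integral>x. max_partial_sum n (\<lambda>i. Z i x) \<partial>N)"
      unfolding \<sigma>[symmetric]
      by (rule integral_perm[OF finite_atMost \<open>\<sigma> permutes {..n}\<close>])
        (rule measurable_max_partial_sum, measurable)
    \<comment> \<open>The two maxima have equal integrals. Pointwise, their difference is at most
      \<open>Z 0 x\<close> where the first maximum is positive, and at most 0 elsewhere because the
      first one vanishes and the second is nonnegative.\<close>
    have "0 = (\<integral>x. max_partial_sum n (\<lambda>i. Z i x) - max_partial_sum n (\<lambda>i. Z (Suc i) x) \<partial>N)"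
      using eq int_max[of n id] int_max[of n Suc] by simp
    also have "\<dots> \<le> (\<integral>x. indicator {x. \<exists>k\<le>n. (\<Sum>i<k. Z i x) > 0} x * Z 0 x \<partial>N)"
    proof (rule integral_mono)
      show "integrable N (\<lambda>x. max_partial_sum n (\<lambda>i. Z i x) - max_partial_sum n (\<lambda>i. Z (Suc i) x))"
        using int_max[of n id] int_max[of n Suc] by simp
      show "integrable N (\<lambda>x. indicator {x. \<exists>k\<le>n. (\<Sum>i<k. Z i x) > 0} x * Z 0 x)"
        by (rule Bochner_Integration.integrable_bound[OF int0]) (auto split: split_indicator)
      show "max_partial_sum n (\<lambda>i. Z i x) - max_partial_sum n (\<lambda>i. Z (Suc i) x)
        \<le> indicator {x. \<exists>k\<le>n. (\<Sum>i<k. Z i x) > 0} x * Z 0 x" for x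
      proof -
        have "indicator {x. \<exists>k\<le>n. (\<Sum>i<k. Z i x) > 0} x
            = (if max_partial_sum n (\<lambda>i. Z i x) > 0 then 1 else (0::real))"
          by (simp add: max_partial_sum_pos_iff)
        then show ?thesis
          using max_partial_sum_shift[of n "\<lambda>i. Z i x"] max_partial_sum_nonneg[of n "\<lambda>i. Z i x"]
            max_partial_sum_nonneg[of n "\<lambda>i. Z (Suc i) x"] by (simp split: if_splits)
      qed
    qed
    finally show ?thesis .
  qed
  have "(\<lambda>n. \<integral>x. indicator {x. \<exists>k\<le>n. (\<Sum>i<k. Z i x) > 0} x * Z 0 x \<partial>N)
      \<longlonglongrightarrow> (\<integral>x. indicator {x. \<exists>k. (\<Sum>i<k. Z i x) > 0} x * Z 0 x \<partial>N)"
  proof (rule integral_dominated_convergence[where w="\<lambda>x. \<bar>Z 0 x\<bar>"])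
    show "AE x in N. (\<lambda>n. indicator {x. \<exists>k\<le>n. (\<Sum>i<k. Z i x) > 0} x * Z 0 x)
      \<longlonglongrightarrow> indicator {x. \<exists>k. (\<Sum>i<k. Z i x) > 0} x * Z 0 x"
    proof (intro AE_I2 tendsto_eventually)
      fix x
      show "\<forall>\<^sub>F n in sequentially. indicator {x. \<exists>k\<le>n. (\<Sum>i<k. Z i x) > 0} x * Z 0 x
        = indicator {x. \<exists>k. (\<Sum>i<k. Z i x) > 0} x * Z 0 x"
      proof (cases "\<exists>k. (\<Sum>i<k. Z i x) > 0")
        case True
        then obtain k where "(\<Sum>i<k. Z i x) > 0" by blast
        then show ?thesis
          by (intro eventually_mono[OF eventually_ge_at_top[of k]]) (auto simp: indicator_def)
      next
        case False
        then show ?thesis by (auto simp: indicator_def)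
      qed
    qed
  qed (use int0 in \<open>auto split: split_indicator\<close>)
  then show ?thesis
    using fin by (intro LIMSEQ_le_const) auto
qed

section \<open>The permutation-invariant field and convergence of averages\<close>

abbreviation inv_field :: "(nat \<Rightarrow> real) measure" where
  "inv_field \<equiv> permutation_invariant_field N (\<lambda>i x. x i)"

lemma sets_inv_field: "sets inv_field = {B \<in> sets real_sequences. permutation_invariant B}"
  unfolding sets_permutation_invariant_field by auto

lemma measurable_coordinate [measurable]: "(\<lambda>x. x i) \<in> borel_measurable N"
  unfolding borel_measurable_iff by (rule measurable_component_singleton) simp

lemma subalgebra_inv_field: "subalgebra N inv_field"
  by (rule subalgebra_permutation_invariant_field) (rule measurable_coordinate)

lemma space_inv_field [simp]: "space inv_field = UNIV"
  using subalgebra_inv_field by (simp add: subalgebra_def)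

sublocale inv_field: finite_measure_subalgebra N inv_field
  by unfold_locales (rule subalgebra_inv_field)

text \<open>The fibre of \<open>Y\<close> through \<open>x\<close> lies in the invariant field, so
  it contains every finite permutation of \<open>x\<close>.\<close>

lemma inv_field_measurable_perm:
  assumes "Y \<in> borel_measurable inv_field" "finite I" "\<pi> permutes I"
  shows "Y (\<lambda>i. x (\<pi> i)) = (Y x :: real)"
proof -
  have "Y -` {Y x} \<inter> space inv_field \<in> sets inv_field"
    using assms(1) by (rule measurable_sets) simp
  then have "permutation_invariant (Y -` {Y x})"
    by (simp add: sets_inv_field)
  then have "(\<lambda>i. x (\<pi> i)) \<in> Y -` {Y x} \<longleftrightarrow> x \<in> Y -` {Y x}"
    using assms(2,3) unfolding permutation_invariant_def by blast
  then show ?thesis by simp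
qed

text \<open>The maximal inequality is applied to \<open>f (x i) - Y x - \<delta>\<close> restricted
  to the invariant set \<open>D\<close> where the bound fails infinitely often. On \<open>D\<close>
  some partial sum is positive, so the inequality reads
  \<open>0 \<le> - \<delta> * measure N D\<close>. \<open>Y\<close> is specified through its
  integrals over invariant sets so that \<open>- f\<close> and \<open>- Y\<close> can be inserted as
  well.\<close>

lemma average_eventually_le:
  assumes [measurable]: "f \<in> borel_measurable borel"
    and int: "integrable N (\<lambda>x. f (x 0))"
    and Y: "Y \<in> borel_measurable inv_field" "integrable N Y"
    and eq: "\<And>A. A \<in> sets inv_field \<Longrightarrow>
      (\<integral>x. indicator A x * f (x 0) \<partial>N) = (\<integral>x. indicator A x * Y x \<partial>N)"
    and "\<delta> > (0::real)"
  shows "AE x in N. \<forall>\<^sub>F n in sequentially. (\<Sum>i<n. f (x i)) / real n \<le> Y x + \<delta>"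
proof -
  have Y_meas [measurable]: "Y \<in> borel_measurable N"
    using Y(2) by (rule borel_measurable_integrable)
  define D where "D = {x. \<forall>m. \<exists>n\<ge>m. n > 0 \<and> (\<Sum>i<n. f (x i)) / real n > Y x + \<delta>}"
  have "{x \<in> space N. \<forall>m. \<exists>n\<ge>m. n > 0 \<and> (\<Sum>i<n. f (x i)) / real n > Y x + \<delta>} \<in> sets N"
    by measurable
  then have D_sets [measurable]: "D \<in> sets N"
    by (simp add: D_def)
  have "permutation_invariant D"
    unfolding permutation_invariant_def
  proof (intro allI impI)
    fix \<pi> and I :: "nat set" and x :: "nat \<Rightarrow> real"
    assume I: "finite I" "\<pi> permutes I"
    then obtain K where K: "I \<subseteq> {..<K}"
      by (metis finite_nat_iff_bounded)
    have sum_eq: "(\<Sum>i<n. f (x (\<pi> i))) = (\<Sum>i<n. f (x i))" if "n \<ge> K" for n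
    proof -
      have "\<pi> permutes {..<n}"
        using I(2) by (rule permutes_subset) (use K that in auto)
      from sum.permute[OF this, of "\<lambda>i. f (x i)"] show ?thesis by (simp add: comp_def)
    qed
    have Yx: "Y (\<lambda>i. x (\<pi> i)) = Y x"
      using Y(1) I by (rule inv_field_measurable_perm)
    define P where "P = (\<lambda>n z. n > 0 \<and> (\<Sum>i<n. f (z i)) / real n > Y z + \<delta>)"
    have P: "P n (\<lambda>i. x (\<pi> i)) \<longleftrightarrow> P n x" if "n \<ge> K" for n
      unfolding P_def sum_eq[OF that] Yx ..
    \<comment> \<open>Only arbitrarily large \<open>n\<close> matter for \<open>D\<close>. Beyond
      \<open>K\<close> the permutation acts inside the range of summation and leaves the sum
      unchanged.\<close>
    have D_alt: "z \<in> D \<longleftrightarrow> (\<forall>m. \<exists>n\<ge>max m K. P n z)" for z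
      unfolding D_def P_def mem_Collect_eq by (metis max.bounded_iff max.cobounded1 max.cobounded2 order_trans)
    show "(\<lambda>i. x (\<pi> i)) \<in> D \<longleftrightarrow> x \<in> D"
      unfolding D_alt using P by (metis max.bounded_iff)
  qed
  then have D_inv: "D \<in> sets inv_field"
    using D_sets by (simp add: sets_inv_field sets_eq)
  \<comment> \<open>Since \<open>D\<close> and \<open>Y\<close> are invariant, permuting
    \<open>x\<close> merely permutes the index of \<open>Z\<close>, as the maximal inequality
    demands.\<close>
  define Z where "Z = (\<lambda>i x. indicator D x * (f (x i) - Y x - \<delta>) :: real)"
  have D_perm: "(\<lambda>i. x (\<pi> i)) \<in> D \<longleftrightarrow> x \<in> D" if "finite I" "\<pi> permutes I" for I \<pi> x
    using \<open>permutation_invariant D\<close> that unfolding permutation_invariant_def by blast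
  have int_f: "integrable N (\<lambda>x. indicator D x * f (x 0))"
    using integrable_mult_indicator[OF D_sets int] by simp
  have int_Y: "integrable N (\<lambda>x. indicator D x * Y x)"
    using integrable_mult_indicator[OF D_sets Y(2)] by simp
  have int_\<delta>: "integrable N (\<lambda>x. indicator D x * \<delta>)"
    using integrable_mult_indicator[OF D_sets integrable_const[of \<delta>]] by simp
  have Z0: "Z 0 = (\<lambda>x. indicator D x * f (x 0) - indicator D x * Y x - indicator D x * \<delta>)"
    by (auto simp: Z_def algebra_simps)
  have "0 \<le> (\<integral>x. indicator {x. \<exists>k. (\<Sum>i<k. Z i x) > 0} x * Z 0 x \<partial>N)"
  proof (rule maximal_inequality)
    show "Z i \<in> borel_measurable N" for i
      unfolding Z_def by measurable
    show "integrable N (Z 0)"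
      unfolding Z0 by (intro Bochner_Integration.integrable_diff int_f int_Y int_\<delta>)
    show "Z i (\<lambda>j. x (\<pi> j)) = Z (\<pi> i) x" if "finite I" "\<pi> permutes I" for I \<pi> i x
      using D_perm[OF that] inv_field_measurable_perm[OF Y(1) that]
      by (simp add: Z_def indicator_def)
  qed
  \<comment> \<open>Off \<open>D\<close> all \<open>Z i\<close> vanish; on \<open>D\<close> an
    average above \<open>Y x + \<delta>\<close> is the same as a positive partial sum of
    \<open>Z\<close>. The indicator can therefore be dropped.\<close>
  also have "(\<lambda>x. indicator {x. \<exists>k. (\<Sum>i<k. Z i x) > 0} x * Z 0 x) = Z 0"
  proof
    fix x
    show "indicator {x. \<exists>k. (\<Sum>i<k. Z i x) > 0} x * Z 0 x = Z 0 x"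
    proof (cases "x \<in> D")
      case True
      then obtain n where n: "n > 0" "(\<Sum>i<n. f (x i)) / real n > Y x + \<delta>"
        by (auto simp: D_def)
      then have "(\<Sum>i<n. Z i x) > 0"
        using True by (simp add: Z_def sum_subtractf field_simps)
      then show ?thesis by (auto simp: indicator_def)
    qed (simp add: Z_def)
  qed
  also have "(\<integral>x. Z 0 x \<partial>N) = - \<delta> * measure N D"
    unfolding Z0 using int_f int_Y int_\<delta> eq[OF D_inv] by simp
  finally have "measure N D = 0"
    using \<open>\<delta> > 0\<close> by (simp add: mult_le_0_iff measure_le_0_iff)
  then have "emeasure N D = 0"
    by (simp add: emeasure_eq_measure)
  then have "AE x in N. x \<notin> D"
    by (intro AE_not_in) (simp add: null_setsI)
  then show ?thesis
  proof (rule AE_mp, intro AE_I2 impI)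
    fix x assume "x \<notin> D"
    then obtain m where "\<And>n. n \<ge> m \<Longrightarrow> n > 0 \<Longrightarrow> (\<Sum>i<n. f (x i)) / real n \<le> Y x + \<delta>"
      by (auto simp: D_def not_less)
    then show "\<forall>\<^sub>F n in sequentially. (\<Sum>i<n. f (x i)) / real n \<le> Y x + \<delta>"
      unfolding eventually_sequentially by (intro exI[of _ "Suc m"]) auto
  qed
qed

lemma integrable_coordinate:
  assumes [measurable]: "f \<in> borel_measurable borel" and int: "integrable N (\<lambda>x. f (x 0) :: real)"
  shows "integrable N (\<lambda>x. f (x i))" "(\<integral>x. f (x i) \<partial>N) = (\<integral>x. f (x 0) \<partial>N)"
proof -
  have p: "Transposition.transpose 0 i permutes {0, i}" by (rule permutes_swap_id) auto
  have m: "(\<lambda>x. f (x 0)) \<in> borel_measurable N" by measurable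
  show "integrable N (\<lambda>x. f (x i))"
    using integrable_perm_iff[OF _ p m] int by simp
  show "(\<integral>x. f (x i) \<partial>N) = (\<integral>x. f (x 0) \<partial>N)"
    using integral_perm[OF _ p m] by simp
qed

lemma integrable_average:
  assumes "f \<in> borel_measurable borel" and "integrable N (\<lambda>x. f (x 0) :: real)"
  shows "integrable N (\<lambda>x. (\<Sum>i<n. f (x i)) / real n)"
  using integrable_coordinate(1)[OF assms] by simp

text \<open>The one-sided bound is used for \<open>f\<close> and for \<open>- f\<close>, with
  \<open>\<delta>\<close> running through the values \<open>1 / real (Suc k)\<close> so that only
  countably many null sets arise.\<close>

lemma average_tendsto_AE:
  assumes [measurable]: "f \<in> borel_measurable borel" and int: "integrable N (\<lambda>x. f (x 0))"
  shows "AE x in N. (\<lambda>n. (\<Sum>i<n. f (x i)) / real n) \<longlonglongrightarrow> real_cond_exp N inv_field (\<lambda>x. f (x 0)) x"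
proof -
  define Y where "Y = real_cond_exp N inv_field (\<lambda>x. f (x 0))"
  have Y: "Y \<in> borel_measurable inv_field" "integrable N Y"
    unfolding Y_def by (rule borel_measurable_cond_exp, rule inv_field.real_cond_exp_int(1)[OF int])
  have eq: "(\<integral>x. indicator A x * f (x 0) \<partial>N) = (\<integral>x. indicator A x * Y x \<partial>N)"
    if "A \<in> sets inv_field" for A
    using inv_field.real_cond_exp_intA[OF int that] by (simp add: Y_def set_lebesgue_integral_def)
  have "AE x in N. \<forall>k. \<forall>\<^sub>F n in sequentially. (\<Sum>i<n. f (x i)) / real n \<le> Y x + 1 / real (Suc k)"
    unfolding AE_all_countable
    by (intro allI average_eventually_le int Y eq) simp_all
  moreover have "AE x in N. \<forall>k. \<forall>\<^sub>F n in sequentially.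
      (\<Sum>i<n. - f (x i)) / real n \<le> - Y x + 1 / real (Suc k)"
    unfolding AE_all_countable
  proof (intro allI average_eventually_le)
    show "(\<integral>x. indicator A x * - f (x 0) \<partial>N) = (\<integral>x. indicator A x * - Y x \<partial>N)"
      if "A \<in> sets inv_field" for A
      using eq[OF that] by simp
  qed (use Y int in simp_all)
  ultimately have "AE x in N. (\<lambda>n. (\<Sum>i<n. f (x i)) / real n) \<longlonglongrightarrow> Y x"
  proof eventually_elim
    fix x
    assume up: "\<forall>k. \<forall>\<^sub>F n in sequentially. (\<Sum>i<n. f (x i)) / real n \<le> Y x + 1 / real (Suc k)"
      and lo: "\<forall>k. \<forall>\<^sub>F n in sequentially. (\<Sum>i<n. - f (x i)) / real n \<le> - Y x + 1 / real (Suc k)"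
    show "(\<lambda>n. (\<Sum>i<n. f (x i)) / real n) \<longlonglongrightarrow> Y x"
    proof (rule tendstoI)
      fix e :: real assume "e > 0"
      then obtain k where k: "1 / real (Suc k) < e"
        by (metis nat_approx_posE)
      show "\<forall>\<^sub>F n in sequentially. dist ((\<Sum>i<n. f (x i)) / real n) (Y x) < e"
        using up[rule_format, of k] lo[rule_format, of k]
      proof eventually_elim
        fix n assume "(\<Sum>i<n. f (x i)) / real n \<le> Y x + 1 / real (Suc k)"
          "(\<Sum>i<n. - f (x i)) / real n \<le> - Y x + 1 / real (Suc k)"
        then show "dist ((\<Sum>i<n. f (x i)) / real n) (Y x) < e"
          using k by (simp add: sum_negf dist_real_def abs_less_iff)
      qed
    qed
  qed
  then show ?thesis unfolding Y_def .
qed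

text \<open>For nonnegative \<open>f\<close> the integrals of the averages do not exceed that of the
  almost sure limit, so Scheffe's lemma upgrades the convergence to L1.\<close>

lemma average_tendsto_L1_nonneg:
  assumes [measurable]: "f \<in> borel_measurable borel" and int: "integrable N (\<lambda>x. f (x 0))"
    and nonneg: "\<And>y. 0 \<le> (f y :: real)"
  shows "(\<lambda>n. \<integral>x. \<bar>(\<Sum>i<n. f (x i)) / real n - real_cond_exp N inv_field (\<lambda>x. f (x 0)) x\<bar> \<partial>N) \<longlonglongrightarrow> 0"
proof -
  define Y where "Y = real_cond_exp N inv_field (\<lambda>x. f (x 0))"
  define A where "A = (\<lambda>n x. (\<Sum>i<n. f (x i)) / real n)"
  have Y: "integrable N Y" "(\<integral>x. Y x \<partial>N) = (\<integral>x. f (x 0) \<partial>N)"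
    unfolding Y_def by (rule inv_field.real_cond_exp_int[OF int])+
  have Y_pos: "AE x in N. Y x \<ge> 0"
    unfolding Y_def by (rule inv_field.real_cond_exp_pos) (use nonneg in simp_all)
  have A_int: "integrable N (A n)" for n
    unfolding A_def using assms(1) int by (rule integrable_average)
  \<comment> \<open>Equality fails only at \<open>n = 0\<close>, where division by zero makes the
    average 0.\<close>
  have A_le: "(\<integral>x. A n x \<partial>N) \<le> (\<integral>x. f (x 0) \<partial>N)" for n
  proof -
    have "(\<integral>x. A n x \<partial>N) = (\<Sum>i<n. \<integral>x. f (x i) \<partial>N) / real n"
      unfolding A_def using integrable_coordinate(1)[OF assms(1) int] by simp
    also have "\<dots> = (\<Sum>i<n. \<integral>x. f (x 0) \<partial>N) / real n"
      by (intro arg_cong[where f="\<lambda>s. s / real n"] sum.cong refl integrable_coordinate(2)[OF assms(1) int])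
    also have "\<dots> \<le> (\<integral>x. f (x 0) \<partial>N)"
      using Bochner_Integration.integral_nonneg[of N "\<lambda>x. f (x 0)"] nonneg by simp
    finally show ?thesis .
  qed
  have "(\<lambda>n. \<integral>\<^sup>+ x. norm (A n x - Y x) \<partial>N) \<longlonglongrightarrow> 0"
  proof (rule Scheffe_lemma2)
    show "A n \<in> borel_measurable N" for n
      using A_int by (rule borel_measurable_integrable)
    show "AE x in N. (\<lambda>n. A n x) \<longlonglongrightarrow> Y x"
      unfolding A_def Y_def by (rule average_tendsto_AE[OF assms(1) int])
    show "(\<integral>\<^sup>+ x. norm (A n x) \<partial>N) \<le> (\<integral>\<^sup>+ x. norm (Y x) \<partial>N)" for n
    proof -
      have "(\<integral>\<^sup>+ x. norm (A n x) \<partial>N) = (\<integral>\<^sup>+ x. A n x \<partial>N)"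
        by (intro nn_integral_cong) (simp add: A_def nonneg sum_nonneg)
      also have "\<dots> = ennreal (\<integral>x. A n x \<partial>N)"
        by (intro nn_integral_eq_integral A_int AE_I2) (simp add: A_def nonneg sum_nonneg)
      also have "\<dots> \<le> ennreal (\<integral>x. Y x \<partial>N)"
        using A_le Y(2) by (intro ennreal_leI) simp
      also have "\<dots> = (\<integral>\<^sup>+ x. Y x \<partial>N)"
        by (intro nn_integral_eq_integral[symmetric] Y Y_pos)
      also have "\<dots> = (\<integral>\<^sup>+ x. norm (Y x) \<partial>N)"
        using Y_pos by (intro nn_integral_cong_AE) auto
      finally show ?thesis .
    qed
  qed (rule Y)
  moreover have "(\<integral>\<^sup>+ x. norm (A n x - Y x) \<partial>N) = ennreal (\<integral>x. \<bar>A n x - Y x\<bar> \<partial>N)" for n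
    unfolding real_norm_def
    by (intro nn_integral_eq_integral integrable_abs Bochner_Integration.integrable_diff A_int Y) simp
  ultimately have "(\<lambda>n. ennreal (\<integral>x. \<bar>A n x - Y x\<bar> \<partial>N)) \<longlonglongrightarrow> ennreal 0"
    by simp
  then have "(\<lambda>n. \<integral>x. \<bar>A n x - Y x\<bar> \<partial>N) \<longlonglongrightarrow> 0"
    by (rule tendsto_ennrealD) simp_all
  then show ?thesis unfolding A_def Y_def .
qed

text \<open>Scheffe's argument needs a sign, so it is run for the positive and the negative part of
  the coordinate separately.\<close>

lemma average_tendsto_L1:
  assumes int: "integrable N (\<lambda>x. x 0)"
  shows "(\<lambda>n. \<integral>x. \<bar>(\<Sum>i<n. x i) / real n - real_cond_exp N inv_field (\<lambda>x. x 0) x\<bar> \<partial>N) \<longlonglongrightarrow> 0"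
proof -
  define p q where "p = (\<lambda>y::real. max y 0)" and "q = (\<lambda>y::real. max (- y) 0)"
  have pq: "y = p y - q y" for y by (simp add: p_def q_def)
  have [measurable]: "p \<in> borel_measurable borel" "q \<in> borel_measurable borel"
    unfolding p_def q_def by measurable
  have p_int: "integrable N (\<lambda>x. p (x 0))" and q_int: "integrable N (\<lambda>x. q (x 0))"
    unfolding p_def q_def using int by (auto intro!: integrable_max)
  define P Q Y where "P = real_cond_exp N inv_field (\<lambda>x. p (x 0))"
    and "Q = real_cond_exp N inv_field (\<lambda>x. q (x 0))"
    and "Y = real_cond_exp N inv_field (\<lambda>x. x 0)"
  have PQY: "integrable N P" "integrable N Q" "integrable N Y"
    unfolding P_def Q_def Y_def by (rule inv_field.real_cond_exp_int, fact)+
  have Y_eq: "AE x in N. Y x = P x - Q x"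
    using inv_field.real_cond_exp_diff[OF p_int q_int] unfolding P_def Q_def Y_def pq[symmetric] .
  have ints: "integrable N (\<lambda>x. (\<Sum>i<n. p (x i)) / real n)" "integrable N (\<lambda>x. (\<Sum>i<n. q (x i)) / real n)"
    "integrable N (\<lambda>x. (\<Sum>i<n. x i) / real n)" for n
    by (rule integrable_average[of p] integrable_average[of q] integrable_average[of "\<lambda>y. y"],
        measurable, fact)+
  have lim: "(\<lambda>n. (\<integral>x. \<bar>(\<Sum>i<n. p (x i)) / real n - P x\<bar> \<partial>N)
      + (\<integral>x. \<bar>(\<Sum>i<n. q (x i)) / real n - Q x\<bar> \<partial>N)) \<longlonglongrightarrow> 0 + 0"
    unfolding P_def Q_def
    by (intro tendsto_add average_tendsto_L1_nonneg p_int q_int) (simp_all add: p_def q_def)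
  have le: "(\<integral>x. \<bar>(\<Sum>i<n. x i) / real n - Y x\<bar> \<partial>N)
      \<le> (\<integral>x. \<bar>(\<Sum>i<n. p (x i)) / real n - P x\<bar> \<partial>N)
        + (\<integral>x. \<bar>(\<Sum>i<n. q (x i)) / real n - Q x\<bar> \<partial>N)" for n
  proof -
    have "(\<integral>x. \<bar>(\<Sum>i<n. x i) / real n - Y x\<bar> \<partial>N)
        \<le> (\<integral>x. \<bar>(\<Sum>i<n. p (x i)) / real n - P x\<bar> + \<bar>(\<Sum>i<n. q (x i)) / real n - Q x\<bar> \<partial>N)"
    proof (rule integral_mono_AE)
      show "AE x in N. \<bar>(\<Sum>i<n. x i) / real n - Y x\<bar>
          \<le> \<bar>(\<Sum>i<n. p (x i)) / real n - P x\<bar> + \<bar>(\<Sum>i<n. q (x i)) / real n - Q x\<bar>"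
        using Y_eq
      proof eventually_elim
        fix x assume "Y x = P x - Q x"
        moreover have "(\<Sum>i<n. x i) = (\<Sum>i<n. p (x i)) - (\<Sum>i<n. q (x i))"
          unfolding sum_subtractf[symmetric] by (intro sum.cong refl pq)
        then have "(\<Sum>i<n. x i) / real n = (\<Sum>i<n. p (x i)) / real n - (\<Sum>i<n. q (x i)) / real n"
          by (simp add: diff_divide_distrib)
        ultimately show "\<bar>(\<Sum>i<n. x i) / real n - Y x\<bar>
          \<le> \<bar>(\<Sum>i<n. p (x i)) / real n - P x\<bar> + \<bar>(\<Sum>i<n. q (x i)) / real n - Q x\<bar>"
          by linarith
      qed
    qed (intro integrable_abs Bochner_Integration.integrable_add Bochner_Integration.integrable_diff ints PQY)+
    also have "\<dots> = (\<integral>x. \<bar>(\<Sum>i<n. p (x i)) / real n - P x\<bar> \<partial>N)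
        + (\<integral>x. \<bar>(\<Sum>i<n. q (x i)) / real n - Q x\<bar> \<partial>N)"
      by (intro Bochner_Integration.integral_add integrable_abs Bochner_Integration.integrable_diff ints PQY)
    finally show ?thesis .
  qed
  have "(\<lambda>n. \<integral>x. \<bar>(\<Sum>i<n. x i) / real n - Y x\<bar> \<partial>N) \<longlonglongrightarrow> 0"
    by (rule tendsto_sandwich[OF _ _ tendsto_const lim[simplified]]) (use le in auto)
  then show ?thesis unfolding Y_def .
qed

end

section \<open>Laws determined by absolute moments of linear forms\<close>

text \<open>
  The difference quotients of \<open>a \<mapsto> \<bar>y - a\<bar>\<close> from the right converge to \<open>1\<close> or \<open>- 1\<close> according to
  whether \<open>y \<le> a\<close> or not.
\<close>

lemma measure_greater_limit:
  assumes "finite_measure M" and int: "integrable M X"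
  shows "(\<lambda>n. (measure M (space M)
      + real (Suc n) * ((\<integral>x. \<bar>X x - a\<bar> \<partial>M) - (\<integral>x. \<bar>X x - (a + 1 / real (Suc n))\<bar> \<partial>M))) / 2)
    \<longlonglongrightarrow> measure M {x \<in> space M. X x > a}"
proof -
  interpret finite_measure M by fact
  have [measurable]: "X \<in> borel_measurable M" using int by (rule borel_measurable_integrable)
  \<comment> \<open>Minus the right difference quotient with step \<open>1 / real (Suc n)\<close>,
    rescaled from [-1, 1] to [0, 1]. It is bounded because the absolute value is 1-Lipschitz, and
    its limit is the indicator of \<open>y > a\<close>.\<close>
  define q where "q = (\<lambda>n y. (1 + real (Suc n) * (\<bar>y - a\<bar> - \<bar>y - (a + 1 / real (Suc n))\<bar>)) / 2)"
  have q_bound: "\<bar>q n y\<bar> \<le> 1" for n y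
  proof -
    have "\<bar>\<bar>y - a\<bar> - \<bar>y - (a + 1 / real (Suc n))\<bar>\<bar> \<le> \<bar>1 / real (Suc n)\<bar>" by linarith
    also have "\<dots> = 1 / real (Suc n)" by simp
    finally have "\<bar>\<bar>y - a\<bar> - \<bar>y - (a + 1 / real (Suc n))\<bar>\<bar> \<le> 1 / real (Suc n)" .
    then have "real (Suc n) * \<bar>\<bar>y - a\<bar> - \<bar>y - (a + 1 / real (Suc n))\<bar>\<bar> \<le> real (Suc n) * (1 / real (Suc n))"
      by (rule mult_left_mono) simp
    then have "\<bar>real (Suc n) * (\<bar>y - a\<bar> - \<bar>y - (a + 1 / real (Suc n))\<bar>)\<bar> \<le> 1"
      by (simp add: abs_mult)
    moreover have "\<bar>(1 + z) / 2\<bar> \<le> 1" if "\<bar>z\<bar> \<le> 1" for z :: real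
      using that by (auto simp: abs_le_iff)
    ultimately show ?thesis unfolding q_def by blast
  qed
  have q_lim: "(\<lambda>n. q n y) \<longlonglongrightarrow> (if y > a then 1 else 0)" for y
  proof (rule tendsto_eventually)
    show "\<forall>\<^sub>F n in sequentially. q n y = (if y > a then 1 else 0)"
    proof (cases "y > a")
      case True
      then obtain m where m: "1 / real (Suc m) < y - a"
        by (metis diff_gt_0_iff_gt nat_approx_posE)
      show ?thesis
      proof (rule eventually_mono[OF eventually_ge_at_top[of m]])
        fix n assume "m \<le> n"
        then have "1 / real (Suc n) \<le> 1 / real (Suc m)" by (simp add: frac_le)
        with m have "\<bar>y - a\<bar> - \<bar>y - (a + 1 / real (Suc n))\<bar> = 1 / real (Suc n)"
          using True by linarith
        then show "q n y = (if y > a then 1 else 0)"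
          using True unfolding q_def by simp
      qed
    next
      case False
      have "q n y = 0" for n
      proof -
        have "0 < 1 / real (Suc n)" by simp
        then have "\<bar>y - a\<bar> - \<bar>y - (a + 1 / real (Suc n))\<bar> = - (1 / real (Suc n))"
          using False by linarith
        then show ?thesis unfolding q_def by simp
      qed
      then show ?thesis using False by simp
    qed
  qed
  have "(\<lambda>n. \<integral>x. q n (X x) \<partial>M) \<longlonglongrightarrow> (\<integral>x. (if X x > a then 1 else 0) \<partial>M)"
  proof (rule integral_dominated_convergence[where w="\<lambda>_. 1"])
    show "(\<lambda>x. q n (X x)) \<in> borel_measurable M" for n
      unfolding q_def by measurable
  qed (use q_lim q_bound in simp_all)
  moreover have "(\<integral>x. q n (X x) \<partial>M) = (measure M (space M)
      + real (Suc n) * ((\<integral>x. \<bar>X x - a\<bar> \<partial>M) - (\<integral>x. \<bar>X x - (a + 1 / real (Suc n))\<bar> \<partial>M))) / 2" for n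
  proof -
    have i: "integrable M (\<lambda>x. \<bar>X x - b\<bar>)" for b
      by (intro integrable_abs Bochner_Integration.integrable_diff int integrable_const)
    show ?thesis
      unfolding q_def using i[of a] i[of "a + 1 / real (Suc n)"] by simp
  qed
  moreover have "(\<integral>x. (if X x > a then 1 else 0) \<partial>M) = measure M {x \<in> space M. X x > a}"
  proof -
    have "(\<integral>x. (if X x > a then 1 else 0) \<partial>M) = (\<integral>x. indicator {x \<in> space M. X x > a} x \<partial>M)"
      by (intro Bochner_Integration.integral_cong) (auto simp: indicator_def)
    also have "\<dots> = measure M {x \<in> space M. X x > a}"
      by (simp add: Int_absorb2 Collect_restrict)
    finally show ?thesis .
  qed
  ultimately show ?thesis by simp
qed

text \<open>The limit formula for the mass of \<open>{x. X x > a}\<close> involves only the total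
  mass and the absolute moments, and open half-lines determine a finite measure on the line.\<close>

lemma distr_eq_of_integral_abs_eq:
  fixes X :: "'a \<Rightarrow> real" and Y :: "'b \<Rightarrow> real"
  assumes "finite_measure M" "finite_measure N" and int: "integrable M X" "integrable N Y"
    and mass: "measure M (space M) = measure N (space N)"
    and eq: "\<And>a. (\<integral>x. \<bar>X x - a\<bar> \<partial>M) = (\<integral>x. \<bar>Y x - a\<bar> \<partial>N)"
  shows "distr M borel X = distr N borel Y"
proof (rule measure_eqI_lessThan)
  interpret M: finite_measure M by fact
  interpret N: finite_measure N by fact
  note [measurable] = borel_measurable_integrable[OF int(1)] borel_measurable_integrable[OF int(2)]
  fix a
  have "measure M {x \<in> space M. X x > a} = measure N {x \<in> space N. Y x > a}"
    using measure_greater_limit[OF assms(1) int(1), of a] measure_greater_limit[OF assms(2) int(2), of a]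
    unfolding mass eq by (rule LIMSEQ_unique)
  moreover have "X -` {a<..} \<inter> space M = {x \<in> space M. X x > a}" "Y -` {a<..} \<inter> space N = {x \<in> space N. Y x > a}"
    by auto
  ultimately show "emeasure (distr M borel X) {a<..} = emeasure (distr N borel Y) {a<..}"
    by (simp add: emeasure_distr M.emeasure_eq_measure N.emeasure_eq_measure)
  show "emeasure (distr M borel X) {a<..} < \<infinity>"
    by (simp add: emeasure_distr M.emeasure_eq_measure)
qed simp_all

section \<open>From characteristic functions to laws of sequences\<close>

lemma weighted_char_unique:
  fixes w :: "'a \<Rightarrow> real"
  assumes "finite_measure M" "finite_measure N" and sets_eq: "sets N = sets M"
    and w [measurable]: "w \<in> borel_measurable M" and w_bound: "\<And>x. 0 \<le> w x" "\<And>x. w x \<le> C"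
    and X [measurable]: "X \<in> borel_measurable M"
    and eq: "\<And>t. (\<integral>x. w x *\<^sub>R iexp (t * X x) \<partial>M) = (\<integral>x. w x *\<^sub>R iexp (t * X x) \<partial>N)"
    and B [measurable]: "B \<in> sets borel"
  shows "(\<integral>x. w x * indicator B (X x) \<partial>M) = (\<integral>x. w x * indicator B (X x) \<partial>N)"
proof -
  interpret M: finite_measure M by fact
  interpret N: finite_measure N by fact
  have wN [measurable]: "w \<in> borel_measurable N" and XN [measurable]: "X \<in> borel_measurable N"
    using w X by (simp_all only: measurable_cong_sets[OF sets_eq refl])
  have int: "integrable M w" "integrable N w"
    by (rule M.integrable_const_bound[where B=C] N.integrable_const_bound[where B=C],
        use w_bound in simp, measurable)+
  define c where "c = (\<integral>x. w x \<partial>M)"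
  \<comment> \<open>Frequency 0 shows that the weight has the same total mass \<open>c\<close> under
    both measures.\<close>
  have "complex_of_real (\<integral>x. w x \<partial>M) = complex_of_real (\<integral>x. w x \<partial>N)"
    using eq[of 0] by (simp add: scaleR_conv_of_real)
  then have cN: "c = (\<integral>x. w x \<partial>N)" unfolding c_def by simp
  have "c \<ge> 0" unfolding c_def using w_bound by simp
  show ?thesis
  proof (cases "c = 0")
    case True
    \<comment> \<open>A weight of mass 0 cannot be normalised, but then both integrals vanish
      anyway.\<close>
    have "AE x in M. w x = 0" "AE x in N. w x = 0"
      using True cN integral_nonneg_eq_0_iff_AE[OF int(1)] integral_nonneg_eq_0_iff_AE[OF int(2)] w_bound
      by (auto simp: c_def)
    then have "(\<integral>x. w x * indicator B (X x) \<partial>M) = (\<integral>x. 0 \<partial>M)"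
      "(\<integral>x. w x * indicator B (X x) \<partial>N) = (\<integral>x. 0 \<partial>N)"
      by (intro integral_cong_AE; auto)+
    then show ?thesis by simp
  next
    case False
    with \<open>c \<ge> 0\<close> have "c > 0" by simp
    \<comment> \<open>Dividing the weight by \<open>c\<close> gives a probability density. The
      characteristic function of the resulting law and its values on sets are the weighted integrals
      divided by \<open>c\<close>, so Levy's theorem applies.\<close>
    define law where "law K = distr (density K (\<lambda>x. ennreal (w x / c))) borel X" for K :: "'a measure"
    have law: "real_distribution (law K)" "char (law K) t = (\<integral>x. w x *\<^sub>R iexp (t * X x) \<partial>K) / c"
      "(\<integral>y. indicator B y \<partial>law K) = (\<integral>x. w x * indicator B (X x) \<partial>K) / c"
      if [measurable]: "w \<in> borel_measurable K" "X \<in> borel_measurable K"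
        and "integrable K w" "(\<integral>x. w x \<partial>K) = c" for K t
    proof -
      have "(\<integral>\<^sup>+x. ennreal (w x / c) \<partial>K) = ennreal (\<integral>x. w x / c \<partial>K)"
        using that w_bound \<open>c > 0\<close> by (intro nn_integral_eq_integral) auto
      also have "\<dots> = 1" using that \<open>c > 0\<close> by simp
      finally have "prob_space (density K (\<lambda>x. ennreal (w x / c)))"
        by (intro prob_spaceI) (simp add: emeasure_density cong: nn_integral_cong)
      then show "real_distribution (law K)"
        unfolding law_def by (rule prob_space.real_distribution_distr) simp
      have "char (law K) t = (\<integral>x. iexp (t * X x) \<partial>density K (\<lambda>x. ennreal (w x / c)))"
        unfolding char_def law_def by (rule integral_distr) simp_all
      also have "\<dots> = (\<integral>x. (w x / c) *\<^sub>R iexp (t * X x) \<partial>K)"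
        using w_bound \<open>c > 0\<close> by (intro integral_density) auto
      also have "\<dots> = (\<integral>x. w x *\<^sub>R iexp (t * X x) / c \<partial>K)"
        by (intro Bochner_Integration.integral_cong refl) (simp add: scaleR_conv_of_real)
      finally show "char (law K) t = (\<integral>x. w x *\<^sub>R iexp (t * X x) \<partial>K) / c" by simp
      have "(\<integral>y. indicator B y \<partial>law K) = (\<integral>x. indicator B (X x) \<partial>density K (\<lambda>x. ennreal (w x / c)) :: real)"
        unfolding law_def by (rule integral_distr) simp_all
      also have "\<dots> = (\<integral>x. (w x / c) *\<^sub>R indicator B (X x) \<partial>K)"
        using w_bound \<open>c > 0\<close> by (intro integral_density) auto
      finally show "(\<integral>y. indicator B y \<partial>law K) = (\<integral>x. w x * indicator B (X x) \<partial>K) / c"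
        by simp
    qed
    have "law M = law N"
    proof (rule Levy_uniqueness)
      show "real_distribution (law M)" "real_distribution (law N)"
        using w X int c_def wN XN cN by (auto intro!: law(1))
      show "char (law M) = char (law N)"
        using law(2)[OF w X int(1) c_def[symmetric]] law(2)[OF wN XN int(2) cN[symmetric]] eq
        by (intro ext) (simp only:)
    qed
    then have "(\<integral>x. w x * indicator B (X x) \<partial>M) / c = (\<integral>x. w x * indicator B (X x) \<partial>N) / c"
      using law(3)[OF w X int(1) c_def[symmetric]] law(3)[OF wN XN int(2) cN[symmetric]] by simp
    then show ?thesis using False by simp
  qed
qed

text \<open>Euler's formulas express the nonnegative factors \<open>1 + cos y\<close> and
  \<open>1 + sin y\<close> by exponentials. Transforms with these weights are then combinations of
  unweighted ones at the arguments \<open>z\<close>, \<open>z + y\<close> and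
  \<open>z - y\<close>.\<close>

lemma iexp_cos_sin:
  "(P * (1 + cos y)) *\<^sub>R iexp z = P *\<^sub>R iexp z + (P *\<^sub>R iexp (z + y) + P *\<^sub>R iexp (z - y)) / 2"
  "(P * (1 + sin y)) *\<^sub>R iexp z = P *\<^sub>R iexp z + (P *\<^sub>R iexp (z + y) - P *\<^sub>R iexp (z - y)) / (2 * \<i>)"
  by (simp_all add: complex_eq_iff Re_exp Im_exp cos_add sin_add cos_diff sin_diff Re_divide Im_divide
      field_simps power2_eq_square)

text \<open>
  Levy's uniqueness theorem is applied to the law of \<open>X\<close> under the nonnegative weights
  \<open>P (1 + cos Y)\<close> and \<open>P (1 + sin Y)\<close>.
\<close>

lemma char_refine:
  fixes P :: "'a \<Rightarrow> real"
  assumes fin: "finite_measure M" "finite_measure N" and sets_eq: "sets N = sets M"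
    and P [measurable]: "P \<in> borel_measurable M" and P_bound: "\<And>x. 0 \<le> P x" "\<And>x. P x \<le> 1"
    and X [measurable]: "X \<in> borel_measurable M" and Y [measurable]: "Y \<in> borel_measurable M"
    and eq: "\<And>t s. (\<integral>x. P x *\<^sub>R iexp (t * X x + s * Y x) \<partial>M) = (\<integral>x. P x *\<^sub>R iexp (t * X x + s * Y x) \<partial>N)"
    and B [measurable]: "B \<in> sets borel"
  shows "(\<integral>x. (P x * indicator B (X x)) *\<^sub>R iexp (Y x) \<partial>M) = (\<integral>x. (P x * indicator B (X x)) *\<^sub>R iexp (Y x) \<partial>N)"
proof -
  interpret M: finite_measure M by fact
  interpret N: finite_measure N by fact
  have [measurable]: "P \<in> borel_measurable N" "X \<in> borel_measurable N" "Y \<in> borel_measurable N"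
    using P X Y by (simp_all only: measurable_cong_sets[OF sets_eq refl])
  have intM: "integrable M (\<lambda>x. P x *\<^sub>R iexp (t * X x + s * Y x))" for t s
    by (rule M.integrable_const_bound[where B=1]) (use P_bound in simp_all)
  have intN: "integrable N (\<lambda>x. P x *\<^sub>R iexp (t * X x + s * Y x))" for t s
    by (rule N.integrable_const_bound[where B=1]) (use P_bound in simp_all)
  \<comment> \<open>The values 0, 1 and -1 of \<open>s\<close> are the three shifts in
    \<open>iexp_cos_sin\<close>.\<close>
  note ints = intM[of _ 0] intM[of _ 1] intM[of _ "- 1"] intN[of _ 0] intN[of _ 1] intN[of _ "- 1"]
  note eqs = eq[of _ 0] eq[of _ 1] eq[of _ "- 1"]
  have "(\<integral>x. P x * indicator B (X x) \<partial>M) = (\<integral>x. P x * indicator B (X x) \<partial>N)"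
    using eqs(1) by (intro weighted_char_unique[OF fin sets_eq P P_bound X _ B]) simp
  moreover have "(\<integral>x. (P x * (1 + cos (Y x))) * indicator B (X x) \<partial>M)
      = (\<integral>x. (P x * (1 + cos (Y x))) * indicator B (X x) \<partial>N)"
  proof (rule weighted_char_unique[OF fin sets_eq, where C=2])
    show "0 \<le> P x * (1 + cos (Y x))" for x
      using cos_ge_minus_one[of "Y x"] by (intro mult_nonneg_nonneg[OF P_bound(1)]) linarith
    show "P x * (1 + cos (Y x)) \<le> 2" for x
      using mult_mono[of "P x" 1 "1 + cos (Y x)" 2] P_bound cos_ge_minus_one[of "Y x"] cos_le_one[of "Y x"]
      by simp
    show "(\<integral>x. (P x * (1 + cos (Y x))) *\<^sub>R iexp (t * X x) \<partial>M)
        = (\<integral>x. (P x * (1 + cos (Y x))) *\<^sub>R iexp (t * X x) \<partial>N)" for t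
      unfolding iexp_cos_sin using ints[of t] eqs[of t] by simp
  qed measurable
  moreover have "(\<integral>x. (P x * (1 + sin (Y x))) * indicator B (X x) \<partial>M)
      = (\<integral>x. (P x * (1 + sin (Y x))) * indicator B (X x) \<partial>N)"
  proof (rule weighted_char_unique[OF fin sets_eq, where C=2])
    show "0 \<le> P x * (1 + sin (Y x))" for x
      using sin_ge_minus_one[of "Y x"] by (intro mult_nonneg_nonneg[OF P_bound(1)]) linarith
    show "P x * (1 + sin (Y x)) \<le> 2" for x
      using mult_mono[of "P x" 1 "1 + sin (Y x)" 2] P_bound sin_ge_minus_one[of "Y x"] sin_le_one[of "Y x"]
      by simp
    show "(\<integral>x. (P x * (1 + sin (Y x))) *\<^sub>R iexp (t * X x) \<partial>M)
        = (\<integral>x. (P x * (1 + sin (Y x))) *\<^sub>R iexp (t * X x) \<partial>N)" for t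
      unfolding iexp_cos_sin using ints[of t] eqs[of t] by simp
  qed measurable
  \<comment> \<open>The real and imaginary parts of \<open>iexp (Y x)\<close> are recovered as
    \<open>(1 + cos (Y x)) - 1\<close> and \<open>(1 + sin (Y x)) - 1\<close>, so three integrals
    with nonnegative weights suffice.\<close>
  moreover have split: "(\<integral>x. (P x * indicator B (X x)) *\<^sub>R iexp (Y x) \<partial>K)
      = complex_of_real ((\<integral>x. (P x * (1 + cos (Y x))) * indicator B (X x) \<partial>K) - (\<integral>x. P x * indicator B (X x) \<partial>K))
        + \<i> * complex_of_real ((\<integral>x. (P x * (1 + sin (Y x))) * indicator B (X x) \<partial>K) - (\<integral>x. P x * indicator B (X x) \<partial>K))"
    if "finite_measure K" and [measurable]: "P \<in> borel_measurable K" "X \<in> borel_measurable K" "Y \<in> borel_measurable K"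
    for K
  proof -
    interpret K: finite_measure K by fact
    have i: "integrable K (\<lambda>x. P x * f (Y x) * indicator B (X x))"
      if [measurable]: "f \<in> borel_measurable borel" and f: "\<And>y. \<bar>f y\<bar> \<le> 1" for f :: "real \<Rightarrow> real"
    proof (rule K.integrable_const_bound[where B=1])
      show "AE x in K. norm (P x * f (Y x) * indicator B (X x)) \<le> 1"
        using P_bound f mult_le_one[of "P _" "\<bar>f (Y _)\<bar>"]
        by (intro AE_I2) (simp add: abs_mult split: split_indicator)
    qed measurable
    have i0: "integrable K (\<lambda>x. P x * indicator B (X x))"
      using i[of "\<lambda>_. 1"] by simp
    have i_cos: "integrable K (\<lambda>x. P x * cos (Y x) * indicator B (X x))"
      and i_sin: "integrable K (\<lambda>x. P x * sin (Y x) * indicator B (X x))"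
      by (rule i; simp)+
    have "(\<integral>x. (P x * indicator B (X x)) *\<^sub>R iexp (Y x) \<partial>K)
        = (\<integral>x. complex_of_real (P x * cos (Y x) * indicator B (X x))
            + \<i> * complex_of_real (P x * sin (Y x) * indicator B (X x)) \<partial>K)"
      by (intro Bochner_Integration.integral_cong refl)
        (simp add: complex_eq_iff Re_exp Im_exp)
    also have "\<dots> = complex_of_real (\<integral>x. P x * cos (Y x) * indicator B (X x) \<partial>K)
        + \<i> * complex_of_real (\<integral>x. P x * sin (Y x) * indicator B (X x) \<partial>K)"
      using i_cos i_sin by (simp del: of_real_mult)
    also have "(\<integral>x. P x * cos (Y x) * indicator B (X x) \<partial>K)
        = (\<integral>x. (P x * (1 + cos (Y x))) * indicator B (X x) \<partial>K) - (\<integral>x. P x * indicator B (X x) \<partial>K)"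
      using i0 i_cos by (simp add: distrib_left distrib_right)
    also have "(\<integral>x. P x * sin (Y x) * indicator B (X x) \<partial>K)
        = (\<integral>x. (P x * (1 + sin (Y x))) * indicator B (X x) \<partial>K) - (\<integral>x. P x * indicator B (X x) \<partial>K)"
      using i0 i_sin by (simp add: distrib_left distrib_right)
    finally show ?thesis .
  qed
  ultimately show ?thesis
    using fin by (subst (1 2) split) simp_all
qed

text \<open>Each induction step trades the frequency variable of one more coordinate for an
  indicator. The form \<open>u\<close> stays arbitrary because the step for coordinate
  \<open>k\<close> uses the hypothesis for forms with a changed \<open>k\<close>-th
  coefficient.\<close>

lemma char_sequence_boxes:
  fixes M N :: "(nat \<Rightarrow> real) measure"
  assumes fin: "finite_measure M" "finite_measure N"
    and sets_eq: "sets M = sets real_sequences" "sets N = sets real_sequences"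
    and eq: "\<And>u. (\<integral>x. iexp (\<Sum>i<d. u i * x i) \<partial>M) = (\<integral>x. iexp (\<Sum>i<d. u i * x i) \<partial>N)"
    and "k \<le> d" and B: "\<And>i. B i \<in> sets borel"
  shows "(\<integral>x. (\<Prod>i<k. indicator (B i) (x i)) *\<^sub>R iexp (\<Sum>i<d. u i * x i) \<partial>M)
    = (\<integral>x. (\<Prod>i<k. indicator (B i) (x i)) *\<^sub>R iexp (\<Sum>i<d. u i * x i) \<partial>N)"
  using \<open>k \<le> d\<close>
proof (induction k arbitrary: u)
  case 0
  then show ?case using eq by simp
next
  case (Suc k)
  have coord [measurable]: "(\<lambda>x. x i) \<in> borel_measurable M" for i
    unfolding measurable_cong_sets[OF sets_eq(1) refl] by (rule measurable_component_singleton) simp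
  note B [measurable]
  have ind: "(\<lambda>x. indicator (B i) (x i) :: real) \<in> borel_measurable M" for i
    by measurable
  have "(\<integral>x. ((\<Prod>i<k. indicator (B i) (x i)) * indicator (B k) (x k)) *\<^sub>R iexp (\<Sum>i<d. u i * x i) \<partial>M)
    = (\<integral>x. ((\<Prod>i<k. indicator (B i) (x i)) * indicator (B k) (x k)) *\<^sub>R iexp (\<Sum>i<d. u i * x i) \<partial>N)"
  proof (rule char_refine[OF fin])
    show "sets N = sets M" using sets_eq by simp
    show "(\<lambda>x. \<Prod>i<k. indicator (B i) (x i) :: real) \<in> borel_measurable M"
      by (intro borel_measurable_prod ind)
    show "(\<lambda>x. \<Sum>i<d. u i * x i) \<in> borel_measurable M"
      by (intro borel_measurable_sum borel_measurable_times coord borel_measurable_const)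
    show "0 \<le> (\<Prod>i<k. indicator (B i) (x i) :: real)" for x
      by (intro prod_nonneg) simp
    show "(\<Prod>i<k. indicator (B i) (x i) :: real) \<le> 1" for x
      by (intro prod_le_1) (simp add: indicator_le_1)
    fix t s
    have lin: "t * x k + s * (\<Sum>i<d. u i * x i) = (\<Sum>i<d. ((if i = k then t else 0) + s * u i) * x i)" for x
    proof -
      have "(\<Sum>i<d. ((if i = k then t else 0) + s * u i) * x i)
          = (\<Sum>i<d. (if i = k then t * x i else 0) + s * (u i * x i))"
        by (intro sum.cong refl) (simp add: distrib_right)
      also have "\<dots> = t * x k + s * (\<Sum>i<d. u i * x i)"
        using Suc.prems by (simp add: sum.distrib sum_distrib_left[symmetric] sum.delta)
      finally show ?thesis by simp
    qed
    show "(\<integral>x. (\<Prod>i<k. indicator (B i) (x i)) *\<^sub>R iexp (t * x k + s * (\<Sum>i<d. u i * x i)) \<partial>M)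
      = (\<integral>x. (\<Prod>i<k. indicator (B i) (x i)) *\<^sub>R iexp (t * x k + s * (\<Sum>i<d. u i * x i)) \<partial>N)"
      unfolding lin by (rule Suc.IH) (use Suc.prems in simp)
  qed (rule coord, rule B)
  then show ?case by simp
qed

lemma measure_eq_of_char_sequence:
  fixes M N :: "(nat \<Rightarrow> real) measure"
  assumes fin: "finite_measure M" "finite_measure N"
    and sets_eq: "sets M = sets real_sequences" "sets N = sets real_sequences"
    and eq: "\<And>d u. (\<integral>x. iexp (\<Sum>i<d. u i * x i) \<partial>M) = (\<integral>x. iexp (\<Sum>i<d. u i * x i) \<partial>N)"
  shows "M = N"
proof (rule measure_eqI_PiM_infinite[OF sets_eq])
  interpret M: finite_measure M by fact
  interpret N: finite_measure N by fact
  show "finite_measure M" by fact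
  fix A and J :: "nat set"
  assume "finite J" and A: "\<And>i. i \<in> J \<Longrightarrow> A i \<in> sets (borel :: real measure)"
  then obtain d where d: "J \<subseteq> {..<d}" by (metis finite_nat_iff_bounded)
  \<comment> \<open>Coordinates outside \<open>J\<close> are left free, which turns the cylinder
    over \<open>J\<close> into a box over an initial segment.\<close>
  define B where "B = (\<lambda>i. if i \<in> J then A i else UNIV)"
  let ?C = "prod_emb UNIV (\<lambda>_. borel) J (Pi\<^sub>E J A) :: (nat \<Rightarrow> real) set"
  have C: "?C \<in> sets real_sequences"
    using \<open>finite J\<close> A by (intro sets_PiM_I) auto
  have C_iff: "x \<in> ?C \<longleftrightarrow> (\<forall>i<d. x i \<in> B i)" for x
    using d by (auto simp: prod_emb_def B_def PiE_iff extensional_def space_PiM)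
  have ind: "indicator ?C x = (\<Prod>i<d. indicator (B i) (x i) :: real)" for x
  proof (cases "x \<in> ?C")
    case True
    then show ?thesis unfolding C_iff by (simp add: C_iff)
  next
    case False
    then obtain i where "i < d" "x i \<notin> B i" unfolding C_iff by blast
    then have "(\<Prod>i<d. indicator (B i) (x i) :: real) = 0"
      by (intro prod_zero bexI[of _ i]) auto
    then show ?thesis using False by simp
  qed
  have "(\<integral>x. (\<Prod>i<d. indicator (B i) (x i)) *\<^sub>R iexp (\<Sum>i<d. 0 * x i) \<partial>M)
    = (\<integral>x. (\<Prod>i<d. indicator (B i) (x i)) *\<^sub>R iexp (\<Sum>i<d. 0 * x i) \<partial>N)"
    by (rule char_sequence_boxes[OF fin sets_eq eq order_refl, where u="\<lambda>_. 0"]) (simp add: B_def A)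
  then have "(\<integral>x. complex_of_real (indicator ?C x) \<partial>M) = (\<integral>x. complex_of_real (indicator ?C x) \<partial>N)"
    by (simp add: ind scaleR_conv_of_real)
  then have "(\<integral>x. indicator ?C x \<partial>M) = (\<integral>x. indicator ?C x \<partial>N :: real)"
    unfolding integral_complex_of_real of_real_eq_iff .
  moreover have "?C \<inter> space M = ?C" "?C \<inter> space N = ?C"
    using sets_eq_imp_space_eq[OF sets_eq(1)] sets_eq_imp_space_eq[OF sets_eq(2)] by auto
  ultimately have "measure M ?C = measure N ?C"
    by simp
  then show "emeasure M ?C = emeasure N ?C"
    by (simp add: M.emeasure_eq_measure N.emeasure_eq_measure)
qed

text \<open>The Cramer-Wold device: absolute moments about every \<open>a\<close> fix the law of
  each linear form, hence its characteristic function, and these functions for all forms fix the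
  measure.\<close>

lemma exchangeable_measureI:
  assumes "finite_measure N" and sets_eq: "sets N = sets real_sequences"
    and int: "\<And>i. integrable N (\<lambda>x. x i)"
    and eq: "\<And>d \<pi> u a. \<pi> permutes {..<d} \<Longrightarrow>
      (\<integral>x. \<bar>(\<Sum>i<d. u i * x (\<pi> i)) - a\<bar> \<partial>N) = (\<integral>x. \<bar>(\<Sum>i<d. u i * x i) - a\<bar> \<partial>N)"
  shows "exchangeable_measure N"
proof (intro exchangeable_measure.intro exchangeable_measure_axioms.intro)
  interpret finite_measure N by fact
  fix I :: "nat set" and \<pi> assume I: "finite I" "\<pi> permutes I"
  have re: "(\<lambda>x i. x (\<pi> i)) \<in> measurable N real_sequences"
    unfolding measurable_cong_sets[OF sets_eq refl] by (rule measurable_reindex)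
  show "distr N real_sequences (\<lambda>x i. x (\<pi> i)) = N"
  proof (rule measure_eq_of_char_sequence)
    show "finite_measure (distr N real_sequences (\<lambda>x i. x (\<pi> i)))"
      using re by (rule finite_measure_distr)
    fix d :: nat and u :: "nat \<Rightarrow> real"
    obtain K where K: "I \<subseteq> {..<K}" using I(1) by (metis finite_nat_iff_bounded)
    \<comment> \<open>The form and the permutation must live on the same initial segment.
      \<open>D\<close> covers both, and \<open>v\<close> pads the coefficients by zeros.\<close>
    define D where "D = max d K"
    have perm: "\<pi> permutes {..<D}"
      using I(2) by (rule permutes_subset) (use K in \<open>auto simp: D_def\<close>)
    define v where "v = (\<lambda>i. if i < d then u i else 0)"
    have v: "(\<Sum>i<d. u i * y i) = (\<Sum>i<D. v i * y i)" for y
      by (intro sum.mono_neutral_cong_left) (auto simp: v_def D_def)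
    have "distr N borel (\<lambda>x. \<Sum>i<D. v i * x (\<pi> i)) = distr N borel (\<lambda>x. \<Sum>i<D. v i * x i)"
      by (rule distr_eq_of_integral_abs_eq)
        (use \<open>finite_measure N\<close> eq[OF perm] in \<open>auto intro!: Bochner_Integration.integrable_sum integrable_mult_right int\<close>)
    then have "(\<integral>y. iexp y \<partial>distr N borel (\<lambda>x. \<Sum>i<D. v i * x (\<pi> i)))
        = (\<integral>y. iexp y \<partial>distr N borel (\<lambda>x. \<Sum>i<D. v i * x i))"
      by (rule arg_cong)
    moreover have "(\<lambda>x. \<Sum>i<D. v i * x (s i)) \<in> borel_measurable N" for s
      by (intro borel_measurable_sum borel_measurable_times borel_measurable_const
          borel_measurable_integrable[OF int])
    from this[of \<pi>] this[of "\<lambda>i. i"] have "(\<integral>y. iexp y \<partial>distr N borel (\<lambda>x. \<Sum>i<D. v i * x (\<pi> i)))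
        = (\<integral>x. iexp (\<Sum>i<D. v i * x (\<pi> i)) \<partial>N)"
      "(\<integral>y. iexp y \<partial>distr N borel (\<lambda>x. \<Sum>i<D. v i * x i)) = (\<integral>x. iexp (\<Sum>i<D. v i * x i) \<partial>N)"
      by (intro integral_distr; simp)+
    moreover have "(\<integral>x. iexp (\<Sum>i<d. u i * x i) \<partial>distr N real_sequences (\<lambda>x i. x (\<pi> i)))
        = (\<integral>x. iexp (\<Sum>i<d. u i * x (\<pi> i)) \<partial>N)"
      by (intro integral_distr re) measurable
    ultimately show "(\<integral>x. iexp (\<Sum>i<d. u i * x i) \<partial>distr N real_sequences (\<lambda>x i. x (\<pi> i)))
        = (\<integral>x. iexp (\<Sum>i<d. u i * x i) \<partial>N)"
      unfolding v by simp
  qed (use \<open>finite_measure N\<close> sets_eq in simp_all)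
qed (fact+)

section \<open>Swap-invariant sequences\<close>

lemma (in prob_space) rademacher_AE:
  assumes "rademacher M \<epsilon>"
  shows "AE \<omega> in M. \<epsilon> \<omega> = 1 \<or> \<epsilon> \<omega> = - 1"
proof -
  have [measurable]: "\<epsilon> \<in> borel_measurable M" using assms by (simp add: rademacher_def)
  have "prob {\<omega> \<in> space M. \<epsilon> \<omega> = 1 \<or> \<epsilon> \<omega> = - 1}
      = prob ({\<omega> \<in> space M. \<epsilon> \<omega> = 1} \<union> {\<omega> \<in> space M. \<epsilon> \<omega> = - 1})"
    by (intro arg_cong[where f=prob]) auto
  also have "\<dots> = prob {\<omega> \<in> space M. \<epsilon> \<omega> = 1} + prob {\<omega> \<in> space M. \<epsilon> \<omega> = - 1}"
    by (intro finite_measure_Union) auto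
  also have "\<dots> = 1" using assms by (simp add: rademacher_def)
  finally show ?thesis by (simp add: prob_Collect_eq_1)
qed

text \<open>Composing \<open>X\<close> with an indicator and \<open>Y\<close> with \<open>h\<close>
  gives real variables whose events belong to the two independent families, so the product rule for
  real independent variables applies.\<close>

lemma (in prob_space) integral_indicator_times_independent:
  fixes h :: "'c \<Rightarrow> real"
  assumes indep: "independent_rvs M S X T Y" and A: "A \<in> sets S"
    and h [measurable]: "h \<in> borel_measurable T" and int: "integrable M (\<lambda>\<omega>. h (Y \<omega>))"
  shows "(\<integral>\<omega>. indicator A (X \<omega>) * h (Y \<omega>) \<partial>M) = prob {\<omega> \<in> space M. X \<omega> \<in> A} * (\<integral>\<omega>. h (Y \<omega>) \<partial>M)"
proof -
  have X [measurable]: "X \<in> measurable M S" and Y [measurable]: "Y \<in> measurable M T"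
    and ind: "indep_set {X -` A \<inter> space M | A. A \<in> sets S} {Y -` B \<inter> space M | B. B \<in> sets T}"
    using indep by (simp_all add: independent_rvs_def)
  note A [measurable]
  have iA: "(\<lambda>x. indicator A x :: real) \<in> borel_measurable S" by measurable
  have stable: "Int_stable {Z -` B \<inter> space M | B. B \<in> sets borel}" for Z :: "'a \<Rightarrow> real"
    unfolding Int_stable_def
  proof (intro ballI)
    fix a b assume "a \<in> {Z -` B \<inter> space M | B. B \<in> sets borel}" "b \<in> {Z -` B \<inter> space M | B. B \<in> sets borel}"
    then obtain B C where "a = Z -` B \<inter> space M" "b = Z -` C \<inter> space M" "B \<in> sets borel" "C \<in> sets borel"
      by blast
    then show "a \<inter> b \<in> {Z -` B \<inter> space M | B. B \<in> sets borel}"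
      by (intro CollectI exI[of _ "B \<inter> C"]) auto
  qed
  have pre: "\<exists>C. (\<lambda>\<omega>. k (Z \<omega>)) -` B \<inter> space M = Z -` C \<inter> space M \<and> C \<in> sets K"
    if "B \<in> sets borel" "k \<in> borel_measurable K" "Z \<in> measurable M K"
    for B :: "real set" and k and Z :: "'a \<Rightarrow> 'd" and K
    using measurable_sets[OF that(2,1)] measurable_space[OF that(3)]
    by (intro exI[of _ "k -` B \<inter> space K"]) auto
  have "indep_var borel (\<lambda>\<omega>. indicator A (X \<omega>) :: real) borel (\<lambda>\<omega>. h (Y \<omega>))"
    unfolding indep_var_eq
  proof (intro conjI indep_set_sigma_sets stable indep_setI)
    show rv: "random_variable borel (\<lambda>\<omega>. indicator A (X \<omega>) :: real)" "random_variable borel (\<lambda>\<omega>. h (Y \<omega>))"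
      by measurable
    show "{(\<lambda>\<omega>. indicator A (X \<omega>) :: real) -` B \<inter> space M | B. B \<in> sets borel} \<subseteq> events"
      "{(\<lambda>\<omega>. h (Y \<omega>)) -` B \<inter> space M | B. B \<in> sets borel} \<subseteq> events"
      using rv by (auto intro: measurable_sets)
    fix a b
    assume "a \<in> {(\<lambda>\<omega>. indicator A (X \<omega>) :: real) -` B \<inter> space M | B. B \<in> sets borel}"
      "b \<in> {(\<lambda>\<omega>. h (Y \<omega>)) -` B \<inter> space M | B. B \<in> sets borel}"
    then have "a \<in> {X -` A \<inter> space M | A. A \<in> sets S}" "b \<in> {Y -` B \<inter> space M | B. B \<in> sets T}"
      using pre[OF _ iA X] pre[OF _ h Y] by blast+
    with ind show "prob (a \<inter> b) = prob a * prob b" by (rule indep_setD)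
  qed
  moreover have "integrable M (\<lambda>\<omega>. indicator A (X \<omega>) :: real)"
    by (rule integrable_const_bound[where B=1]) (auto simp: indicator_le_1)
  ultimately have "(\<integral>\<omega>. indicator A (X \<omega>) * h (Y \<omega>) \<partial>M) = (\<integral>\<omega>. indicator A (X \<omega>) \<partial>M) * (\<integral>\<omega>. h (Y \<omega>) \<partial>M)"
    using int by (rule indep_var_lebesgue_integral)
  also have "(\<integral>\<omega>. indicator A (X \<omega>) \<partial>M) = (\<integral>\<omega>. indicator {\<omega> \<in> space M. X \<omega> \<in> A} \<omega> \<partial>M :: real)"
    by (intro Bochner_Integration.integral_cong) (auto simp: indicator_def)
  also have "\<dots> = prob {\<omega> \<in> space M. X \<omega> \<in> A}"
    by (simp add: Int_def conj_commute)
  finally show ?thesis .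
qed

text \<open>On each of the events \<open>\<epsilon> = 1\<close> and \<open>\<epsilon> = - 1\<close>
  the sign can be frozen, which leaves an indicator in \<open>\<epsilon>\<close> times a function of
  \<open>Y\<close>. Joint measurability is a separate hypothesis because \<open>f s\<close> is
  assumed measurable only for each fixed \<open>s\<close>.\<close>

lemma (in prob_space) integral_rademacher:
  fixes f :: "real \<Rightarrow> 'c \<Rightarrow> real"
  assumes rad: "rademacher M \<epsilon>" and indep: "independent_rvs M borel \<epsilon> T Y"
    and f: "\<And>s. f s \<in> borel_measurable T" and int: "\<And>s. integrable M (\<lambda>\<omega>. f s (Y \<omega>))"
    and meas: "(\<lambda>\<omega>. f (\<epsilon> \<omega>) (Y \<omega>)) \<in> borel_measurable M"
  shows "(\<integral>\<omega>. f (\<epsilon> \<omega>) (Y \<omega>) \<partial>M) = ((\<integral>\<omega>. f 1 (Y \<omega>) \<partial>M) + (\<integral>\<omega>. f (- 1) (Y \<omega>) \<partial>M)) / 2"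
proof -
  have \<epsilon> [measurable]: "\<epsilon> \<in> borel_measurable M" using rad by (simp add: rademacher_def)
  have Y [measurable]: "Y \<in> measurable M T" using indep by (simp add: independent_rvs_def)
  note f [measurable]
  have i: "integrable M (\<lambda>\<omega>. indicator {s} (\<epsilon> \<omega>) * f s (Y \<omega>))" for s
    by (rule Bochner_Integration.integrable_bound[OF int[of s]]) (auto split: split_indicator)
  have "(\<integral>\<omega>. f (\<epsilon> \<omega>) (Y \<omega>) \<partial>M)
      = (\<integral>\<omega>. indicator {1} (\<epsilon> \<omega>) * f 1 (Y \<omega>) + indicator {- 1} (\<epsilon> \<omega>) * f (- 1) (Y \<omega>) \<partial>M)"
  proof (rule integral_cong_AE[OF meas])
    show "(\<lambda>\<omega>. indicator {1} (\<epsilon> \<omega>) * f 1 (Y \<omega>) + indicator {- 1} (\<epsilon> \<omega>) * f (- 1) (Y \<omega>)) \<in> borel_measurable M"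
      using i by (intro borel_measurable_add borel_measurable_integrable)
    show "AE \<omega> in M. f (\<epsilon> \<omega>) (Y \<omega>)
        = indicator {1} (\<epsilon> \<omega>) * f 1 (Y \<omega>) + indicator {- 1} (\<epsilon> \<omega>) * f (- 1) (Y \<omega>)"
      using rademacher_AE[OF rad] by eventually_elim auto
  qed
  also have "\<dots> = prob {\<omega> \<in> space M. \<epsilon> \<omega> \<in> {1}} * (\<integral>\<omega>. f 1 (Y \<omega>) \<partial>M)
      + prob {\<omega> \<in> space M. \<epsilon> \<omega> \<in> {- 1}} * (\<integral>\<omega>. f (- 1) (Y \<omega>) \<partial>M)"
    using i by (simp add: integral_indicator_times_independent[OF indep _ f int])
  also have "\<dots> = ((\<integral>\<omega>. f 1 (Y \<omega>) \<partial>M) + (\<integral>\<omega>. f (- 1) (Y \<omega>) \<partial>M)) / 2"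
  proof -
    have half: "prob {\<omega> \<in> space M. \<epsilon> \<omega> = 1} = 1 / 2" "prob {\<omega> \<in> space M. \<epsilon> \<omega> = - 1} = 1 / 2"
      using rad unfolding rademacher_def by blast+
    show ?thesis unfolding singleton_iff half by (simp add: add_divide_distrib)
  qed
  finally show ?thesis .
qed

text \<open>Coordinate 0 provides the normalisation later on, so swap invariance is used only for
  permutations \<open>\<sigma>\<close> that fix 0 and move the remaining indices by
  \<open>\<pi>\<close>.\<close>

lemma swap_invariant_sequence_perm:
  assumes "swap_invariant_sequence M X" and \<pi>: "\<pi> permutes {..<d}"
  shows "(\<integral>\<omega>. \<bar>b * X 0 \<omega> + (\<Sum>i<d. u i * X (Suc (\<pi> i)) \<omega>)\<bar> \<partial>M)
    = (\<integral>\<omega>. \<bar>b * X 0 \<omega> + (\<Sum>i<d. u i * X (Suc i) \<omega>)\<bar> \<partial>M)"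
proof -
  define \<sigma> where "\<sigma> = case_nat 0 (\<lambda>j. Suc (\<pi> j))"
  have "\<sigma> permutes {..<Suc d}"
  proof (rule bij_imp_permutes)
    have "inv \<pi> permutes {..<d}" using \<pi> by (rule permutes_inv)
    then show "bij_betw \<sigma> {..<Suc d} {..<Suc d}"
      using permutes_inverses[OF \<pi>] permutes_in_image[OF \<pi>] permutes_in_image[of "inv \<pi>" "{..<d}"]
      by (intro bij_betw_byWitness[where f'="case_nat 0 (\<lambda>j. Suc (inv \<pi> j))"])
        (auto simp: \<sigma>_def split: nat.splits)
    show "\<sigma> i = i" if "i \<notin> {..<Suc d}" for i
      using that permutes_not_in[OF \<pi>] by (auto simp: \<sigma>_def split: nat.splits)
  qed
  moreover have "swap_invariant_vector M (Suc d) (\<lambda>i. X i)"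
    using assms(1) unfolding swap_invariant_sequence_def
    by (elim conjE allE[of _ "Suc d"] allE[of _ "\<lambda>i. i"]) (simp add: strict_mono_on_def)
  ultimately have "zonoid_equivalent (Suc d) M (\<lambda>i. X (\<sigma> i)) M (\<lambda>i. X (id i))"
    using permutes_id unfolding swap_invariant_vector_def by blast
  then have "(\<integral>\<omega>. \<bar>\<Sum>i<Suc d. case_nat b u i * X (\<sigma> i) \<omega>\<bar> \<partial>M)
      = (\<integral>\<omega>. \<bar>\<Sum>i<Suc d. case_nat b u i * X (id i) \<omega>\<bar> \<partial>M)"
    unfolding zonoid_equivalent_def by blast
  then show ?thesis
    unfolding sum.lessThan_Suc_shift by (simp add: \<sigma>_def)
qed

theorem corollary23:
  fixes M :: "'a measure" and \<xi> :: "nat \<Rightarrow> 'a \<Rightarrow> real" and \<epsilon> :: "'a \<Rightarrow> real"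
  assumes "prob_space M"
    and "swap_invariant_sequence M \<xi>"
    and "AE \<omega> in M. \<xi> 0 \<omega> \<noteq> 0"
    and "rademacher M \<epsilon>"
    and "independent_rvs M borel \<epsilon> real_sequences (\<lambda>\<omega> i. \<xi> i \<omega>)"
  shows
    "let \<E> = permutation_invariant_field M (\<lambda>i \<omega>. \<epsilon> \<omega> * \<xi> (Suc i) \<omega> / \<bar>\<xi> 0 \<omega>\<bar>);
         S = (\<lambda>n \<omega>. 1 / real n * (\<Sum>i<n. \<xi> i \<omega>));
         L = (\<lambda>\<omega>. \<bar>\<xi> 0 \<omega>\<bar> / (real_cond_exp M \<E> (\<lambda>\<omega>. \<bar>\<xi> 0 \<omega>\<bar>) \<omega> * \<epsilon> \<omega>)
                 * real_cond_exp M \<E> (\<lambda>\<omega>. \<epsilon> \<omega> * \<xi> 1 \<omega>) \<omega>)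
     in (AE \<omega> in M. (\<lambda>n. S n \<omega>) \<longlonglongrightarrow> L \<omega>) \<and> converges_in_L1 M S L"
proof -
  interpret prob_space M by fact
  have int_\<xi>: "integrable M (\<xi> i)" for i
    using assms(2) by (simp add: swap_invariant_sequence_def)
  have \<xi>_meas [measurable]: "\<xi> i \<in> borel_measurable M" for i
    using int_\<xi> by (rule borel_measurable_integrable)
  have \<epsilon>_meas [measurable]: "\<epsilon> \<in> borel_measurable M"
    using assms(4) by (simp add: rademacher_def)
  have sign: "AE \<omega> in M. \<epsilon> \<omega> = 1 \<or> \<epsilon> \<omega> = - 1"
    using assms(4) by (rule rademacher_AE)
  define \<eta> where "\<eta> = (\<lambda>i \<omega>. \<epsilon> \<omega> * \<xi> (Suc i) \<omega> / \<bar>\<xi> 0 \<omega>\<bar>)"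
  have \<eta>_meas [measurable]: "\<eta> i \<in> borel_measurable M" for i
    unfolding \<eta>_def by measurable
  have \<eta>_seq: "(\<lambda>\<omega> i. \<eta> i \<omega>) \<in> measurable M real_sequences"
    by (rule measurable_PiM_single') (use \<eta>_meas in \<open>auto simp: space_PiM\<close>)
  \<comment> \<open>The one place where the quotient is cancelled; from here on the weight and
    \<open>\<eta>\<close> are combined through this identity.\<close>
  have \<eta>_eq: "AE \<omega> in M. \<forall>i. \<bar>\<xi> 0 \<omega>\<bar> * \<eta> i \<omega> = \<epsilon> \<omega> * \<xi> (Suc i) \<omega>"
    using assms(3) by eventually_elim (simp add: \<eta>_def)
  define Q where "Q = density M (\<lambda>\<omega>. ennreal \<bar>\<xi> 0 \<omega>\<bar>)"
  define N where "N = distr Q real_sequences (\<lambda>\<omega> i. \<eta> i \<omega>)"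
  have \<eta>_seq_Q: "(\<lambda>\<omega> i. \<eta> i \<omega>) \<in> measurable Q real_sequences"
    using \<eta>_seq by (simp add: Q_def)
  have integral_N: "(\<integral>x. h x \<partial>N) = (\<integral>\<omega>. \<bar>\<xi> 0 \<omega>\<bar> * h (\<lambda>i. \<eta> i \<omega>) \<partial>M)"
    and integrable_N: "integrable N h \<longleftrightarrow> integrable M (\<lambda>\<omega>. \<bar>\<xi> 0 \<omega>\<bar> * h (\<lambda>i. \<eta> i \<omega>))"
    if h: "h \<in> borel_measurable real_sequences" for h :: "(nat \<Rightarrow> real) \<Rightarrow> real"
  proof -
    have h\<eta>: "(\<lambda>\<omega>. h (\<lambda>i. \<eta> i \<omega>)) \<in> borel_measurable M"
      using \<eta>_seq h by (rule measurable_compose)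
    have a: "(\<lambda>\<omega>. \<bar>\<xi> 0 \<omega>\<bar>) \<in> borel_measurable M" "AE \<omega> in M. 0 \<le> \<bar>\<xi> 0 \<omega>\<bar>" by auto
    show "(\<integral>x. h x \<partial>N) = (\<integral>\<omega>. \<bar>\<xi> 0 \<omega>\<bar> * h (\<lambda>i. \<eta> i \<omega>) \<partial>M)"
      unfolding N_def integral_distr[OF \<eta>_seq_Q h] unfolding Q_def integral_density[OF h\<eta> a] by simp
    show "integrable N h \<longleftrightarrow> integrable M (\<lambda>\<omega>. \<bar>\<xi> 0 \<omega>\<bar> * h (\<lambda>i. \<eta> i \<omega>))"
      unfolding N_def integrable_distr_eq[OF \<eta>_seq_Q h] unfolding Q_def integrable_density[OF h\<eta> a] by simp
  qed
  \<comment> \<open>The density of \<open>Q\<close> is positive almost everywhere, so null sets of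
    \<open>N\<close> pull back to null sets of \<open>M\<close>.\<close>
  have AE_N: "AE \<omega> in M. P (\<lambda>i. \<eta> i \<omega>)" if "AE x in N. P x" for P
  proof -
    have "AE \<omega> in Q. P (\<lambda>i. \<eta> i \<omega>)"
      using AE_distrD[OF \<eta>_seq_Q that[unfolded N_def]] .
    then have "AE \<omega> in M. 0 < ennreal \<bar>\<xi> 0 \<omega>\<bar> \<longrightarrow> P (\<lambda>i. \<eta> i \<omega>)"
      unfolding Q_def by (subst (asm) AE_density) simp_all
    with assms(3) show ?thesis by eventually_elim simp
  qed
  have coord: "(\<lambda>x. x i) \<in> borel_measurable real_sequences" for i
    by (rule measurable_component_singleton) simp
  have int_\<epsilon>\<xi>: "integrable M (\<lambda>\<omega>. \<epsilon> \<omega> * \<xi> i \<omega>)" for i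
    by (rule Bochner_Integration.integrable_bound[OF int_\<xi>[of i]])
      (use sign in \<open>auto elim!: eventually_mono simp: abs_mult\<close>)
  have int_coord: "integrable N (\<lambda>x. x i)" for i
  proof -
    have "integrable M (\<lambda>\<omega>. \<bar>\<xi> 0 \<omega>\<bar> * \<eta> i \<omega>)"
      by (rule integrable_cong_AE_imp[OF int_\<epsilon>\<xi>[of "Suc i"]])
        (use \<eta>_eq in \<open>auto elim!: eventually_mono\<close>)
    then show ?thesis by (simp add: integrable_N[OF coord])
  qed
  have "finite_measure Q"
  proof (rule finite_measureI)
    have "emeasure Q (space Q) = (\<integral>\<^sup>+\<omega>. ennreal \<bar>\<xi> 0 \<omega>\<bar> \<partial>M)"
      by (simp add: Q_def emeasure_density cong: nn_integral_cong)
    also have "\<dots> = ennreal (\<integral>\<omega>. \<bar>\<xi> 0 \<omega>\<bar> \<partial>M)"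
      by (intro nn_integral_eq_integral integrable_abs int_\<xi>) simp
    finally show "emeasure Q (space Q) \<noteq> \<infinity>" by simp
  qed
  then have finite_N: "finite_measure N"
    unfolding N_def by (rule finite_measure.finite_measure_distr) (rule \<eta>_seq_Q)
  interpret N: exchangeable_measure N
  proof (rule exchangeable_measureI[OF finite_N])
    show "sets N = sets real_sequences" by (simp add: N_def)
    show "integrable N (\<lambda>x. x i)" for i by (rule int_coord)
    fix d :: nat and \<pi> u and a :: real
    assume \<pi>: "\<pi> permutes {..<d}"
    have symmetrize: "(\<integral>x. \<bar>(\<Sum>i<d. u i * x (s i)) - a\<bar> \<partial>N)
      = ((\<integral>\<omega>. \<bar>a * \<xi> 0 \<omega> + (\<Sum>i<d. u i * \<xi> (Suc (s i)) \<omega>)\<bar> \<partial>M)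
        + (\<integral>\<omega>. \<bar>(- a) * \<xi> 0 \<omega> + (\<Sum>i<d. u i * \<xi> (Suc (s i)) \<omega>)\<bar> \<partial>M)) / 2" for s
    proof -
      \<comment> \<open>The integrand after the weight has been multiplied in, with the sign frozen
        to \<open>e\<close>.\<close>
      define f where "f = (\<lambda>e x. \<bar>e * (\<Sum>i<d. u i * x (Suc (s i))) - a * \<bar>x 0\<bar>\<bar>)" for e and x :: "nat \<Rightarrow> real"
      have f_meas: "f e \<in> borel_measurable real_sequences" for e
        unfolding f_def using coord by (intro borel_measurable_abs borel_measurable_diff
            borel_measurable_times borel_measurable_sum borel_measurable_const coord)
      have int_sum: "integrable M (\<lambda>\<omega>. \<Sum>i<d. u i * \<xi> (Suc (s i)) \<omega>)"
        by (intro Bochner_Integration.integrable_sum integrable_mult_right int_\<xi>)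
      have f_int: "integrable M (\<lambda>\<omega>. f e (\<lambda>i. \<xi> i \<omega>))" for e
        unfolding f_def by (intro integrable_abs Bochner_Integration.integrable_diff
            integrable_mult_right int_sum int_\<xi>)
      have "(\<integral>x. \<bar>(\<Sum>i<d. u i * x (s i)) - a\<bar> \<partial>N)
          = (\<integral>\<omega>. \<bar>\<xi> 0 \<omega>\<bar> * \<bar>(\<Sum>i<d. u i * \<eta> (s i) \<omega>) - a\<bar> \<partial>M)"
        by (rule integral_N) (intro borel_measurable_abs borel_measurable_diff
            borel_measurable_times borel_measurable_sum borel_measurable_const coord)
      also have "\<dots> = (\<integral>\<omega>. f (\<epsilon> \<omega>) (\<lambda>i. \<xi> i \<omega>) \<partial>M)"
      proof (rule integral_cong_AE)
        show "AE \<omega> in M. \<bar>\<xi> 0 \<omega>\<bar> * \<bar>(\<Sum>i<d. u i * \<eta> (s i) \<omega>) - a\<bar> = f (\<epsilon> \<omega>) (\<lambda>i. \<xi> i \<omega>)"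
          using \<eta>_eq
        proof eventually_elim
          fix \<omega> assume *: "\<forall>i. \<bar>\<xi> 0 \<omega>\<bar> * \<eta> i \<omega> = \<epsilon> \<omega> * \<xi> (Suc i) \<omega>"
          have "\<bar>\<xi> 0 \<omega>\<bar> * \<bar>(\<Sum>i<d. u i * \<eta> (s i) \<omega>) - a\<bar>
              = \<bar>\<bar>\<xi> 0 \<omega>\<bar> * ((\<Sum>i<d. u i * \<eta> (s i) \<omega>) - a)\<bar>"
            by (simp add: abs_mult)
          also have "\<bar>\<xi> 0 \<omega>\<bar> * ((\<Sum>i<d. u i * \<eta> (s i) \<omega>) - a)
              = (\<Sum>i<d. u i * (\<bar>\<xi> 0 \<omega>\<bar> * \<eta> (s i) \<omega>)) - a * \<bar>\<xi> 0 \<omega>\<bar>"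
            by (simp add: right_diff_distrib sum_distrib_left mult_ac)
          also have "\<dots> = \<epsilon> \<omega> * (\<Sum>i<d. u i * \<xi> (Suc (s i)) \<omega>) - a * \<bar>\<xi> 0 \<omega>\<bar>"
            unfolding *[rule_format] by (simp add: sum_distrib_left mult_ac)
          finally show "\<bar>\<xi> 0 \<omega>\<bar> * \<bar>(\<Sum>i<d. u i * \<eta> (s i) \<omega>) - a\<bar> = f (\<epsilon> \<omega>) (\<lambda>i. \<xi> i \<omega>)"
            by (simp add: f_def)
        qed
      qed (unfold f_def, measurable)
      also have "\<dots> = ((\<integral>\<omega>. f 1 (\<lambda>i. \<xi> i \<omega>) \<partial>M) + (\<integral>\<omega>. f (- 1) (\<lambda>i. \<xi> i \<omega>) \<partial>M)) / 2"
      proof (rule integral_rademacher[OF assms(4,5)])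
        show "(\<lambda>\<omega>. f (\<epsilon> \<omega>) (\<lambda>i. \<xi> i \<omega>)) \<in> borel_measurable M"
          unfolding f_def by measurable
      qed (rule f_meas f_int)+
      also have "(\<integral>\<omega>. f 1 (\<lambda>i. \<xi> i \<omega>) \<partial>M) + (\<integral>\<omega>. f (- 1) (\<lambda>i. \<xi> i \<omega>) \<partial>M)
          = (\<integral>\<omega>. f 1 (\<lambda>i. \<xi> i \<omega>) + f (- 1) (\<lambda>i. \<xi> i \<omega>) \<partial>M)"
        by (rule Bochner_Integration.integral_add[symmetric]) (rule f_int)+
      also have "\<dots> = (\<integral>\<omega>. \<bar>a * \<xi> 0 \<omega> + (\<Sum>i<d. u i * \<xi> (Suc (s i)) \<omega>)\<bar>
          + \<bar>(- a) * \<xi> 0 \<omega> + (\<Sum>i<d. u i * \<xi> (Suc (s i)) \<omega>)\<bar> \<partial>M)"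
      proof (rule Bochner_Integration.integral_cong[OF refl])
        fix \<omega>
        \<comment> \<open>With \<open>c = a * \<bar>y\<bar>\<close> the left side is
          \<open>\<bar>z - c\<bar> + \<bar>z + c\<bar>\<close>, which is even in \<open>c\<close>;
          hence \<open>\<bar>y\<bar>\<close> may be replaced by \<open>y\<close>.\<close>
        have "\<bar>1 * z - a * \<bar>y\<bar>\<bar> + \<bar>- 1 * z - a * \<bar>y\<bar>\<bar> = \<bar>a * y + z\<bar> + \<bar>(- a) * y + z\<bar>" for y z :: real
          by (cases "y \<ge> 0") (simp_all add: abs_if)
        then show "f 1 (\<lambda>i. \<xi> i \<omega>) + f (- 1) (\<lambda>i. \<xi> i \<omega>)
          = \<bar>a * \<xi> 0 \<omega> + (\<Sum>i<d. u i * \<xi> (Suc (s i)) \<omega>)\<bar>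
          + \<bar>(- a) * \<xi> 0 \<omega> + (\<Sum>i<d. u i * \<xi> (Suc (s i)) \<omega>)\<bar>"
          unfolding f_def .
      qed
      also have "\<dots> = (\<integral>\<omega>. \<bar>a * \<xi> 0 \<omega> + (\<Sum>i<d. u i * \<xi> (Suc (s i)) \<omega>)\<bar> \<partial>M)
          + (\<integral>\<omega>. \<bar>(- a) * \<xi> 0 \<omega> + (\<Sum>i<d. u i * \<xi> (Suc (s i)) \<omega>)\<bar> \<partial>M)"
        by (intro Bochner_Integration.integral_add integrable_abs Bochner_Integration.integrable_add
            integrable_mult_right int_sum int_\<xi>)
      finally show ?thesis .
    qed
    show "(\<integral>x. \<bar>(\<Sum>i<d. u i * x (\<pi> i)) - a\<bar> \<partial>N) = (\<integral>x. \<bar>(\<Sum>i<d. u i * x i) - a\<bar> \<partial>N)"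
      unfolding symmetrize[of \<pi>] symmetrize[of "\<lambda>i. i"] swap_invariant_sequence_perm[OF assms(2) \<pi>] ..
  qed
  define g where "g = real_cond_exp N N.inv_field (\<lambda>x. x 0)"
  define E where "E = permutation_invariant_field M \<eta>"
  have E_sub: "subalgebra M E"
    unfolding E_def by (rule subalgebra_permutation_invariant_field) (rule \<eta>_meas)
  interpret E: finite_measure_subalgebra M E
    by unfold_locales (rule E_sub)
  have g_meas: "g \<in> borel_measurable N.inv_field" "g \<in> borel_measurable real_sequences"
    and g_int: "integrable N g"
    unfolding g_def N.borel_measurable_iff[symmetric]
    by (rule borel_measurable_cond_exp, rule borel_measurable_cond_exp2,
        rule N.inv_field.real_cond_exp_int(1)[OF int_coord])
  define G where "G = (\<lambda>\<omega>. g (\<lambda>i. \<eta> i \<omega>))"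
  \<comment> \<open>\<open>E\<close> is the pullback of the invariant field of sequence space along
    \<open>\<eta>\<close>, which carries the defining integrals of \<open>g\<close> over to
    \<open>M\<close>.\<close>
  have E_sets: "A \<in> sets E \<longleftrightarrow> (\<exists>B\<in>sets N.inv_field. A = {\<omega> \<in> space M. (\<lambda>i. \<eta> i \<omega>) \<in> B})" for A
    unfolding E_def N.sets_inv_field by (subst sets_permutation_invariant_field) blast
  have \<eta>_E: "(\<lambda>\<omega> i. \<eta> i \<omega>) \<in> measurable E N.inv_field"
  proof (rule measurableI)
    fix B assume B: "B \<in> sets N.inv_field"
    have "space E = space M" using E_sub by (simp add: subalgebra_def)
    then have "(\<lambda>\<omega> i. \<eta> i \<omega>) -` B \<inter> space E = {\<omega> \<in> space M. (\<lambda>i. \<eta> i \<omega>) \<in> B}" by auto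
    with B show "(\<lambda>\<omega> i. \<eta> i \<omega>) -` B \<inter> space E \<in> sets E"
      unfolding E_sets by blast
  qed simp
  have G_meas: "G \<in> borel_measurable E"
    unfolding G_def using \<eta>_E g_meas(1) by (rule measurable_compose)
  have G_meas' [measurable]: "G \<in> borel_measurable M"
    using E_sub G_meas by (rule measurable_from_subalg)
  have G_int: "integrable M (\<lambda>\<omega>. G \<omega> * \<bar>\<xi> 0 \<omega>\<bar>)"
    using g_int integrable_N[OF g_meas(2)] by (simp add: G_def mult.commute)
  define W where "W = real_cond_exp M E (\<lambda>\<omega>. \<bar>\<xi> 0 \<omega>\<bar>)"
  define V where "V = real_cond_exp M E (\<lambda>\<omega>. \<epsilon> \<omega> * \<xi> 1 \<omega>)"
  \<comment> \<open>Conditioning preserves almost sure strict positivity, so the denominator of the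
    limit does not vanish.\<close>
  have W_pos: "AE \<omega> in M. W \<omega> > 0"
    unfolding W_def by (rule E.real_cond_exp_gr_c) (use assms(3) int_\<xi> in auto)
  \<comment> \<open>Bayes' rule for the change of measure. Over a set of \<open>E\<close>,
    \<open>W\<close> may be replaced by \<open>\<bar>\<xi> 0\<bar>\<close> since the other factor is
    \<open>E\<close>-measurable; the integral then moves to \<open>N\<close>, where \<open>g\<close>
    is replaced by coordinate 0, and back to \<open>M\<close>.\<close>
  have V_eq: "AE \<omega> in M. V \<omega> = G \<omega> * W \<omega>"
    unfolding V_def
  proof (rule E.real_cond_exp_charact)
    show "integrable M (\<lambda>\<omega>. \<epsilon> \<omega> * \<xi> 1 \<omega>)" by (rule int_\<epsilon>\<xi>)
    show "integrable M (\<lambda>\<omega>. G \<omega> * W \<omega>)"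
      unfolding W_def using G_int G_meas by (rule E.real_cond_exp_intg(1)) simp
    show "(\<lambda>\<omega>. G \<omega> * W \<omega>) \<in> borel_measurable E"
      unfolding W_def using G_meas by (rule borel_measurable_times) (rule borel_measurable_cond_exp)
    fix A assume A: "A \<in> sets E"
    then obtain B where B: "B \<in> sets N.inv_field" and A_eq: "A = {\<omega> \<in> space M. (\<lambda>i. \<eta> i \<omega>) \<in> B}"
      unfolding E_sets by blast
    have B': "B \<in> sets real_sequences" using B by (simp add: N.sets_inv_field)
    have A' [measurable]: "A \<in> sets M" using A E_sub by (auto simp: subalgebra_def)
    have "set_lebesgue_integral M A (\<lambda>\<omega>. G \<omega> * W \<omega>) = (\<integral>\<omega>. (indicator A \<omega> * G \<omega>) * W \<omega> \<partial>M)"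
      by (simp add: set_lebesgue_integral_def mult.assoc)
    also have "\<dots> = (\<integral>\<omega>. (indicator A \<omega> * G \<omega>) * \<bar>\<xi> 0 \<omega>\<bar> \<partial>M)"
      unfolding W_def
    proof (rule E.real_cond_exp_intg(2))
      show "integrable M (\<lambda>\<omega>. indicator A \<omega> * G \<omega> * \<bar>\<xi> 0 \<omega>\<bar>)"
        using integrable_mult_indicator[OF A' G_int] by (simp add: mult.assoc)
      show "(\<lambda>\<omega>. indicator A \<omega> * G \<omega>) \<in> borel_measurable E"
        using G_meas A by simp
    qed simp
    also have "\<dots> = (\<integral>\<omega>. \<bar>\<xi> 0 \<omega>\<bar> * (indicator B (\<lambda>i. \<eta> i \<omega>) * g (\<lambda>i. \<eta> i \<omega>)) \<partial>M)"
      by (intro Bochner_Integration.integral_cong refl) (auto simp: A_eq G_def indicator_def)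
    also have "\<dots> = (\<integral>x. indicator B x * g x \<partial>N)"
      using B' g_meas(2) by (intro integral_N[symmetric]) simp
    also have "\<dots> = (\<integral>x. indicator B x * x 0 \<partial>N)"
      using N.inv_field.real_cond_exp_intA[OF int_coord B] by (simp add: g_def set_lebesgue_integral_def)
    also have "\<dots> = (\<integral>\<omega>. \<bar>\<xi> 0 \<omega>\<bar> * (indicator B (\<lambda>i. \<eta> i \<omega>) * \<eta> 0 \<omega>) \<partial>M)"
      using B' coord by (intro integral_N) simp
    also have "\<dots> = (\<integral>\<omega>. indicator A \<omega> * (\<epsilon> \<omega> * \<xi> 1 \<omega>) \<partial>M)"
    proof (rule integral_cong_AE)
      have "(\<lambda>\<omega>. indicator B (\<lambda>i. \<eta> i \<omega>) :: real) \<in> borel_measurable M"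
        using \<eta>_seq by (rule measurable_compose) (use B' in simp)
      then show "(\<lambda>\<omega>. \<bar>\<xi> 0 \<omega>\<bar> * (indicator B (\<lambda>i. \<eta> i \<omega>) * \<eta> 0 \<omega>)) \<in> borel_measurable M"
        by simp
      show "AE \<omega> in M. \<bar>\<xi> 0 \<omega>\<bar> * (indicator B (\<lambda>i. \<eta> i \<omega>) * \<eta> 0 \<omega>) = indicator A \<omega> * (\<epsilon> \<omega> * \<xi> 1 \<omega>)"
        using \<eta>_eq AE_space by eventually_elim (auto simp: A_eq indicator_def)
    qed measurable
    finally show "set_lebesgue_integral M A (\<lambda>\<omega>. \<epsilon> \<omega> * \<xi> 1 \<omega>) = set_lebesgue_integral M A (\<lambda>\<omega>. G \<omega> * W \<omega>)"
      by (simp add: set_lebesgue_integral_def)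
  qed
  define L where "L = (\<lambda>\<omega>. \<bar>\<xi> 0 \<omega>\<bar> / (W \<omega> * \<epsilon> \<omega>) * V \<omega>)"
  have L_meas [measurable]: "L \<in> borel_measurable M"
    unfolding L_def W_def V_def by (intro borel_measurable_times borel_measurable_divide
        borel_measurable_cond_exp2 \<epsilon>_meas borel_measurable_abs \<xi>_meas)
  \<comment> \<open>\<open>W\<close> cancels, and division by a sign is multiplication by
    it.\<close>
  have L_eq: "AE \<omega> in M. L \<omega> = \<epsilon> \<omega> * (G \<omega> * \<bar>\<xi> 0 \<omega>\<bar>)"
    using W_pos V_eq sign by eventually_elim (auto simp: L_def)
  have L_int: "integrable M L"
    by (rule Bochner_Integration.integrable_bound[OF G_int])
      (use L_eq sign in \<open>auto elim: eventually_elim2\<close>)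
  define S where "S = (\<lambda>n \<omega>. 1 / real n * (\<Sum>i<n. \<xi> i \<omega>))"
  have S_int: "integrable M (S n)" for n
    unfolding S_def by (intro integrable_mult_right Bochner_Integration.integrable_sum int_\<xi>)
  define A where "A = (\<lambda>n \<omega>. (\<Sum>i<n. \<eta> i \<omega>) / real n)"
  have A_meas [measurable]: "A n \<in> borel_measurable M" for n
    unfolding A_def by measurable
  \<comment> \<open>The average of \<open>n + 1\<close> terms of \<open>\<xi>\<close> consists of
    \<open>\<xi> 0\<close> and \<open>n\<close> terms of \<open>\<eta>\<close>, whence the factor
    \<open>real n / real (Suc n)\<close>. A second factor \<open>\<epsilon>\<close> undoes the one
    inside \<open>\<eta>\<close>.\<close>
  have S_eq: "AE \<omega> in M. \<forall>n. S (Suc n) \<omega> = \<xi> 0 \<omega> / real (Suc n)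
      + real n / real (Suc n) * (\<epsilon> \<omega> * (\<bar>\<xi> 0 \<omega>\<bar> * A n \<omega>))"
    using \<eta>_eq sign
  proof eventually_elim
    fix \<omega> assume *: "\<forall>i. \<bar>\<xi> 0 \<omega>\<bar> * \<eta> i \<omega> = \<epsilon> \<omega> * \<xi> (Suc i) \<omega>" and "\<epsilon> \<omega> = 1 \<or> \<epsilon> \<omega> = - 1"
    then have \<epsilon>2: "\<epsilon> \<omega> * (\<epsilon> \<omega> * z) = z" for z by auto
    show "\<forall>n. S (Suc n) \<omega> = \<xi> 0 \<omega> / real (Suc n)
      + real n / real (Suc n) * (\<epsilon> \<omega> * (\<bar>\<xi> 0 \<omega>\<bar> * A n \<omega>))"
    proof
      fix n
      have "real n * (\<epsilon> \<omega> * (\<bar>\<xi> 0 \<omega>\<bar> * A n \<omega>)) = \<epsilon> \<omega> * (\<bar>\<xi> 0 \<omega>\<bar> * (\<Sum>i<n. \<eta> i \<omega>))"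
        by (cases "n = 0") (simp_all add: A_def)
      also have "\<dots> = (\<Sum>i<n. \<epsilon> \<omega> * (\<bar>\<xi> 0 \<omega>\<bar> * \<eta> i \<omega>))"
        by (simp add: sum_distrib_left)
      also have "\<dots> = (\<Sum>i<n. \<xi> (Suc i) \<omega>)"
        using * by (simp add: \<epsilon>2)
      finally have "real n / real (Suc n) * (\<epsilon> \<omega> * (\<bar>\<xi> 0 \<omega>\<bar> * A n \<omega>)) = (\<Sum>i<n. \<xi> (Suc i) \<omega>) / real (Suc n)"
        by (metis times_divide_eq_left)
      then show "S (Suc n) \<omega> = \<xi> 0 \<omega> / real (Suc n)
        + real n / real (Suc n) * (\<epsilon> \<omega> * (\<bar>\<xi> 0 \<omega>\<bar> * A n \<omega>))"
        unfolding S_def sum.lessThan_Suc_shift by (simp add: add_divide_distrib)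
    qed
  qed
  have "AE \<omega> in M. (\<lambda>n. A n \<omega>) \<longlonglongrightarrow> G \<omega>"
    unfolding A_def G_def g_def
    by (rule AE_N) (rule N.average_tendsto_AE[of "\<lambda>y. y", OF _ int_coord], simp)
  with S_eq L_eq have S_lim: "AE \<omega> in M. (\<lambda>n. S n \<omega>) \<longlonglongrightarrow> L \<omega>"
  proof eventually_elim
    fix \<omega>
    assume S: "\<forall>n. S (Suc n) \<omega> = \<xi> 0 \<omega> / real (Suc n) + real n / real (Suc n) * (\<epsilon> \<omega> * (\<bar>\<xi> 0 \<omega>\<bar> * A n \<omega>))"
      and L: "L \<omega> = \<epsilon> \<omega> * (G \<omega> * \<bar>\<xi> 0 \<omega>\<bar>)" and A: "(\<lambda>n. A n \<omega>) \<longlonglongrightarrow> G \<omega>"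
    have "(\<lambda>n. \<xi> 0 \<omega> / real (Suc n) + real n / real (Suc n) * (\<epsilon> \<omega> * (\<bar>\<xi> 0 \<omega>\<bar> * A n \<omega>)))
        \<longlonglongrightarrow> 0 + 1 * (\<epsilon> \<omega> * (\<bar>\<xi> 0 \<omega>\<bar> * G \<omega>))"
      by (intro tendsto_add tendsto_mult tendsto_const A LIMSEQ_n_over_Suc_n LIMSEQ_Suc[OF lim_const_over_n])
    then have "(\<lambda>n. S (Suc n) \<omega>) \<longlonglongrightarrow> L \<omega>"
      using S L by (simp add: mult.commute)
    then show "(\<lambda>n. S n \<omega>) \<longlonglongrightarrow> L \<omega>" by (rule LIMSEQ_imp_Suc)
  qed
  have int_A: "integrable M (\<lambda>\<omega>. \<bar>\<xi> 0 \<omega>\<bar> * \<bar>A n \<omega> - G \<omega>\<bar>)"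
    and integral_A: "(\<integral>\<omega>. \<bar>\<xi> 0 \<omega>\<bar> * \<bar>A n \<omega> - G \<omega>\<bar> \<partial>M) = (\<integral>x. \<bar>(\<Sum>i<n. x i) / real n - g x\<bar> \<partial>N)" for n
  proof -
    have m: "(\<lambda>x. \<bar>(\<Sum>i<n. x i) / real n - g x\<bar>) \<in> borel_measurable real_sequences"
      using g_meas(2) coord by (intro borel_measurable_abs borel_measurable_diff
          borel_measurable_divide borel_measurable_sum borel_measurable_const)
    show "integrable M (\<lambda>\<omega>. \<bar>\<xi> 0 \<omega>\<bar> * \<bar>A n \<omega> - G \<omega>\<bar>)"
      unfolding A_def G_def integrable_N[OF m, symmetric]
      by (intro integrable_abs Bochner_Integration.integrable_diff g_int N.integrable_average[of "\<lambda>y. y"]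
          int_coord) simp
    show "(\<integral>\<omega>. \<bar>\<xi> 0 \<omega>\<bar> * \<bar>A n \<omega> - G \<omega>\<bar> \<partial>M) = (\<integral>x. \<bar>(\<Sum>i<n. x i) / real n - g x\<bar> \<partial>N)"
      unfolding A_def G_def by (rule integral_N[OF m, symmetric])
  qed
  \<comment> \<open>The three terms bound the contribution of \<open>\<xi> 0\<close>, the L1 error
    under \<open>N\<close>, and the part of \<open>L\<close> lost because
    \<open>real n / real (Suc n)\<close> falls short of 1 by
    \<open>1 / real (Suc n)\<close>.\<close>
  have S_le: "(\<integral>\<omega>. \<bar>S (Suc n) \<omega> - L \<omega>\<bar> \<partial>M) \<le> (\<integral>\<omega>. \<bar>\<xi> 0 \<omega>\<bar> \<partial>M) / real (Suc n)
      + (\<integral>x. \<bar>(\<Sum>i<n. x i) / real n - g x\<bar> \<partial>N) + (\<integral>\<omega>. \<bar>L \<omega>\<bar> \<partial>M) / real (Suc n)" for n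
  proof -
    have "(\<integral>\<omega>. \<bar>S (Suc n) \<omega> - L \<omega>\<bar> \<partial>M)
        \<le> (\<integral>\<omega>. \<bar>\<xi> 0 \<omega>\<bar> / real (Suc n) + \<bar>\<xi> 0 \<omega>\<bar> * \<bar>A n \<omega> - G \<omega>\<bar> + \<bar>L \<omega>\<bar> / real (Suc n) \<partial>M)"
    proof (rule integral_mono_AE)
      show "AE \<omega> in M. \<bar>S (Suc n) \<omega> - L \<omega>\<bar>
          \<le> \<bar>\<xi> 0 \<omega>\<bar> / real (Suc n) + \<bar>\<xi> 0 \<omega>\<bar> * \<bar>A n \<omega> - G \<omega>\<bar> + \<bar>L \<omega>\<bar> / real (Suc n)"
        using S_eq L_eq sign
      proof eventually_elim
        fix \<omega>
        assume S: "\<forall>n. S (Suc n) \<omega> = \<xi> 0 \<omega> / real (Suc n) + real n / real (Suc n) * (\<epsilon> \<omega> * (\<bar>\<xi> 0 \<omega>\<bar> * A n \<omega>))"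
          and L: "L \<omega> = \<epsilon> \<omega> * (G \<omega> * \<bar>\<xi> 0 \<omega>\<bar>)" and \<epsilon>: "\<epsilon> \<omega> = 1 \<or> \<epsilon> \<omega> = - 1"
        define r where "r = real n / real (Suc n)"
        have r: "0 \<le> r" "r \<le> 1" "1 - r = 1 / real (Suc n)"
          by (simp_all add: r_def field_simps)
        have "S (Suc n) \<omega> - L \<omega>
            = \<xi> 0 \<omega> / real (Suc n) + r * (\<epsilon> \<omega> * (\<bar>\<xi> 0 \<omega>\<bar> * (A n \<omega> - G \<omega>))) - (1 - r) * L \<omega>"
          unfolding S[rule_format] r_def[symmetric] L by (simp add: algebra_simps)
        also have "\<bar>\<dots>\<bar> \<le> \<bar>\<xi> 0 \<omega> / real (Suc n)\<bar> + \<bar>r * (\<epsilon> \<omega> * (\<bar>\<xi> 0 \<omega>\<bar> * (A n \<omega> - G \<omega>)))\<bar> + \<bar>(1 - r) * L \<omega>\<bar>"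
          by linarith
        also have "\<bar>r * (\<epsilon> \<omega> * (\<bar>\<xi> 0 \<omega>\<bar> * (A n \<omega> - G \<omega>)))\<bar> = r * (\<bar>\<xi> 0 \<omega>\<bar> * \<bar>A n \<omega> - G \<omega>\<bar>)"
          using \<epsilon> r(1) by (auto simp: abs_mult)
        also have "\<dots> \<le> \<bar>\<xi> 0 \<omega>\<bar> * \<bar>A n \<omega> - G \<omega>\<bar>"
          using r by (intro mult_left_le_one_le) simp_all
        finally show "\<bar>S (Suc n) \<omega> - L \<omega>\<bar>
          \<le> \<bar>\<xi> 0 \<omega>\<bar> / real (Suc n) + \<bar>\<xi> 0 \<omega>\<bar> * \<bar>A n \<omega> - G \<omega>\<bar> + \<bar>L \<omega>\<bar> / real (Suc n)"
          unfolding r(3) by (simp add: abs_mult)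
      qed
    qed (intro integrable_abs Bochner_Integration.integrable_add Bochner_Integration.integrable_diff
        integrable_divide int_A S_int L_int int_\<xi>)+
    also have "\<dots> = (\<integral>\<omega>. \<bar>\<xi> 0 \<omega>\<bar> \<partial>M) / real (Suc n)
      + (\<integral>x. \<bar>(\<Sum>i<n. x i) / real n - g x\<bar> \<partial>N) + (\<integral>\<omega>. \<bar>L \<omega>\<bar> \<partial>M) / real (Suc n)"
      unfolding integral_A[symmetric] using int_A L_int int_\<xi> by simp
    finally show ?thesis .
  qed
  have "(\<lambda>n. (\<integral>\<omega>. \<bar>\<xi> 0 \<omega>\<bar> \<partial>M) / real (Suc n)
      + (\<integral>x. \<bar>(\<Sum>i<n. x i) / real n - g x\<bar> \<partial>N) + (\<integral>\<omega>. \<bar>L \<omega>\<bar> \<partial>M) / real (Suc n)) \<longlonglongrightarrow> 0 + 0 + 0"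
    unfolding g_def
    by (intro tendsto_add LIMSEQ_Suc[OF lim_const_over_n] N.average_tendsto_L1 int_coord)
  then have bound_lim: "(\<lambda>n. (\<integral>\<omega>. \<bar>\<xi> 0 \<omega>\<bar> \<partial>M) / real (Suc n)
      + (\<integral>x. \<bar>(\<Sum>i<n. x i) / real n - g x\<bar> \<partial>N) + (\<integral>\<omega>. \<bar>L \<omega>\<bar> \<partial>M) / real (Suc n)) \<longlonglongrightarrow> 0"
    by simp
  have "(\<lambda>n. \<integral>\<omega>. \<bar>S (Suc n) \<omega> - L \<omega>\<bar> \<partial>M) \<longlonglongrightarrow> 0"
    by (rule tendsto_sandwich[OF _ _ tendsto_const bound_lim]) (use S_le in auto)
  then have "(\<lambda>n. \<integral>\<omega>. \<bar>S n \<omega> - L \<omega>\<bar> \<partial>M) \<longlonglongrightarrow> 0"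
    by (rule LIMSEQ_imp_Suc)
  with S_lim S_int L_int have "(AE \<omega> in M. (\<lambda>n. S n \<omega>) \<longlonglongrightarrow> L \<omega>) \<and> converges_in_L1 M S L"
    unfolding converges_in_L1_def by blast
  then show ?thesis
    unfolding Let_def S_def L_def V_def W_def E_def \<eta>_def .
qed

end
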